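(* Let $m,n\geq 2$ be integers with $m\neq n$, let $\varepsilon_1,\varepsilon_2,\alpha,c\in\mathbb{C}$, put $\hbar=\varepsilon_1+\varepsilon_2$, and assume $\hbar c=(-m+n)\varepsilon_1$ and $z=1$. Let $\mathrm{ev}_{\varepsilon_1,\varepsilon_2}\colon Y_{\varepsilon_1,\varepsilon_2}(\widehat{\mathfrak{sl}}(m|n))\to U(\widehat{\mathfrak{gl}}(m|n))_{\rm comp}$ be the evaluation map. If $\varepsilon_1\neq 0$, then the image of $\mathrm{ev}_{\varepsilon_1,\varepsilon_2}$ is dense in $U(\widehat{\mathfrak{gl}}(m|n))_{\rm comp}$.
   Context: Parity. $p(i)=0$ for $1\le i\le m$, $p(i)=1$ for $m+1\le i\le m+n$, and $p(0)=p(m+n)=1$. $p(E_{i,j})=p(i)+p(j)$. Brackets $[\cdot,\cdot]$ are supercommutators; $\{x,y\}=xy+yx$. Affine super Yangian. $Y_{\varepsilon_1,\varepsilon_2}(\widehat{\mathfrak{sl}}(m|n))$ is the associative superalgebra over $\mathbb{C}$ with generators $x^+_{i,r},x^-_{i,r},h_{i,r}$ ($i\in\{0,\dots,m+n-1\}$, $r\in\mathbb{Z}_{\ge0}$; the indices $i\pm1$ in the last relation are read modulo $m+n$), where $x^\pm_{0,r},x^\pm_{m,r}$ are odd and all other generators are even, and relations $$[h_{i,r},h_{j,s}]=0,\quad [x^+_{i,r},x^-_{j,s}]=\delta_{ij}h_{i,r+s},\quad [h_{i,0},x^\pm_{j,r}]=\pm a_{ij}x^\pm_{j,r},$$ $$[h_{i,r+1},x^\pm_{j,s}]-[h_{i,r},x^\pm_{j,s+1}]=\pm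 a_{ij}\tfrac{\varepsilon_1+\varepsilon_2}{2}\{h_{i,r},x^\pm_{j,s}\}-m_{ij}\tfrac{\varepsilon_1-\varepsilon_2}{2}[h_{i,r},x^\pm_{j,s}],$$ $$[x^\pm_{i,r+1},x^\pm_{j,s}]-[x^\pm_{i,r},x^\pm_{j,s+1}]=\pm a_{ij}\tfrac{\varepsilon_1+\varepsilon_2}{2}\{x^\pm_{i,r},x^\pm_{j,s}\}-m_{ij}\tfrac{\varepsilon_1-\varepsilon_2}{2}[x^\pm_{i,r},x^\pm_{j,s}],$$ $$\sum_{w\in\mathfrak{S}_{1+|a_{ij}|}}[x^\pm_{i,r_{w(1)}},[x^\pm_{i,r_{w(2)}},\dots,[x^\pm_{i,r_{w(1+|a_{ij}|)}},x^\pm_{j,s}]\dots]]=0\quad(i\ne j),$$ $$[x^\pm_{i,r},x^\pm_{i,s}]=0\ (i=0,m),\qquad [[x^\pm_{i-1,r},x^\pm_{i,0}],[x^\pm_{i,0},x^\pm_{i+1,s}]]=0\ (i=0,m).$$ Here $a_{ii}=(-1)^{p(i)}+(-1)^{p(i+1)}$; $a_{ij}=-(-1)^{p(i+1)}$ if $j=i+1$; $a_{ij}=-(-1)^{p(i)}$ if $j=i-1$; $a_{0,m+n-1}=a_{m+n-1,0}=1$; $a_{ij}=0$ otherwise. And $m_{ij}=-(-1)^{p(i+1)}$ if $j=i+1$; $m_{ij}=(-1)^{p(i)}$ if $j=i-1$; $m_{0,m+n-1}=-1$; $m_{m+n-1,0}=1$; $m_{ij}=0$ otherwise. The Lie superalgebra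 $\widehat{\mathfrak{gl}}(m|n)=\mathfrak{gl}(m|n)\otimes\mathbb{C}[t^{\pm1}]\oplus\mathbb{C}c\oplus\mathbb{C}z$ has $c,z$ central and $$[x\otimes t^u,y\otimes t^v]=[x,y]\otimes t^{u+v}+u\delta_{u+v,0}\big(\mathrm{str}(xy)\,c+\mathrm{str}(x)\,\mathrm{str}(y)\,z\big).$$ $E_{i,j}$ are the matrix units, $E_{i,j}(s)=E_{i,j}\otimes t^s$, $E_{i,j}=E_{i,j}(0)$. In $U(\widehat{\mathfrak{gl}}(m|n))$ the central elements $c,z$ are specialized to complex numbers (here $z=1$ and $c$ as in the claim). Grade $U=U(\widehat{\mathfrak{gl}}(m|n))=\bigoplus_d U_d$ by $\deg E_{i,j}(s)=s$. The degreewise completion is $U(\widehat{\mathfrak{gl}}(m|n))_{\rm comp}=\bigoplus_d \varprojlim_N U_d/\sum_{r>N}U_{d-r}U_r$, with its inverse-limit topology in each degree. Evaluation map. Set $h_0=-E_{1,1}-E_{m+n,m+n}+c$, $h_i=(-1)^{p(i)}E_{i,i}-(-1)^{p(i+1)}E_{i+1,i+1}$ for $1\le i\le m+n-1$; $x_0^+=E_{m+n,1}(1)$, $x_0^-=-E_{1,m+n}(-1)$; $x_i^+=E_{i,i+1}$, $x_i^-=(-1)^{p(i)}E_{i+1,i}$ for $i\neq0$. It is known that, when $\hbar c=(-m+n)\varepsilon_1$ and $z=1$, there is a unique algebra homomorphism $\mathrm{ev}_{\varepsilon_1,\varepsilon_2}$ with $x^\pm_{i,0}\mapsto x^\pm_i$,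 $h_{i,0}\mapsto h_i$, $$h_{0,1}\mapsto(\alpha-(m-n)\varepsilon_1)h_0+\hbar E_{m+n,m+n}(E_{1,1}-c)-\hbar\sum_{s\ge0}\sum_{k=1}^{m+n}(-1)^{p(k)}E_{m+n,k}(-s)E_{k,m+n}(s)-\hbar\sum_{s\ge0}\sum_{k=1}^{m+n}(-1)^{p(k)}E_{1,k}(-s-1)E_{k,1}(s+1),$$ and for $1\le i\le m+n-1$, with $\delta(i\ge m+1)=1$ if $i\ge m+1$ and $0$ otherwise, $$\begin{aligned}h_{i,1}\mapsto{}&(\alpha-(i-2\delta(i\ge m+1)(i-m))\varepsilon_1)h_i-(-1)^{p(E_{i,i+1})}\hbar E_{i,i}E_{i+1,i+1}\\&+\hbar(-1)^{p(i)}\sum_{s\ge0}\sum_{k=1}^{i}(-1)^{p(k)}E_{i,k}(-s)E_{k,i}(s)+\hbar(-1)^{p(i)}\sum_{s\ge0}\sum_{k=i+1}^{m+n}(-1)^{p(k)}E_{i,k}(-s-1)E_{k,i}(s+1)\\&-\hbar(-1)^{p(i+1)}\sum_{s\ge0}\sum_{k=1}^{i}(-1)^{p(k)}E_{i+1,k}(-s)E_{k,i+1}(s)-\hbar(-1)^{p(i+1)}\sum_{s\ge0}\sum_{k=i+1}^{m+n}(-1)^{p(k)}E_{i+1,k}(-s-1)E_{k,i+1}(s+1).\end{aligned}$$ *)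

theory Defs
  imports
    "HOL-Analysis.Analysis"
    "HOL-Algebra.Algebra"
    "HOL-Library.Poly_Mapping"
    "HOL-Combinatorics.Permutations"
begin

section \<open>Free associative superalgebras\<close>

text \<open>
  Words over an alphabet form the free monoid under concatenation, so that
  finitely supported functions from words to \<open>\<complex>\<close>, with the convolution product of
  \<^theory>\<open>HOL-Library.Poly_Mapping\<close>, form the free associative algebra.
\<close>

instantiation list :: (type) monoid_add
begin
definition zero_list :: "'a list" where "zero_list = []"
definition plus_list :: "'a list \<Rightarrow> 'a list \<Rightarrow> 'a list" where "plus_list = append"
instance by standard (auto simp: zero_list_def plus_list_def)
end

type_synonym 'g falg = "'g list \<Rightarrow>\<^sub>0 complex"

definition gen :: "'g \<Rightarrow> 'g falg" where
  "gen g = Poly_Mapping.single [g] 1"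

definition scal :: "complex \<Rightarrow> 'g falg" where
  "scal a = Poly_Mapping.single [] a"

definition free_algebra :: "'g set \<Rightarrow> 'g falg ring" where
  "free_algebra G =
     \<lparr>carrier = {f. \<forall>w \<in> Poly_Mapping.keys f. set w \<subseteq> G},
      mult = (*), one = 1, ring.zero = 0, add = (+)\<rparr>"

definition part :: "('g list \<Rightarrow> bool) \<Rightarrow> 'g falg \<Rightarrow> 'g falg" where
  "part P f = (\<Sum>w \<in> {w \<in> Poly_Mapping.keys f. P w}. Poly_Mapping.single w (Poly_Mapping.lookup f w))"

definition word_odd :: "('g \<Rightarrow> bool) \<Rightarrow> 'g list \<Rightarrow> bool" where
  "word_odd odd_gen w \<longleftrightarrow> odd (length (filter odd_gen w))"

text \<open>
  The supercommutator: the bilinear extension of \<open>xy - (-1)\<^bsup>|x||y|\<^esup> yx\<close> from homogeneous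
  elements, applied to the even and odd components of \<open>f\<close> and \<open>g\<close>.
\<close>

definition sbracket :: "('g \<Rightarrow> bool) \<Rightarrow> 'g falg \<Rightarrow> 'g falg \<Rightarrow> 'g falg" where
  "sbracket odd_gen f g =
     (\<Sum>a \<in> UNIV. \<Sum>b \<in> UNIV.
        (let x = part (\<lambda>w. word_odd odd_gen w = a) f;
             y = part (\<lambda>w. word_odd odd_gen w = b) g
         in x * y - (if a \<and> b then -1 else 1) * (y * x)))"

definition anticomm :: "'g falg \<Rightarrow> 'g falg \<Rightarrow> 'g falg" where
  "anticomm f g = f * g + g * f"

definition presented_algebra :: "'g set \<Rightarrow> 'g falg set \<Rightarrow> 'g falg set ring" where
  "presented_algebra G R = free_algebra G Quot genideal (free_algebra G) R"

definition pcls :: "'g set \<Rightarrow> 'g falg set \<Rightarrow> 'g falg \<Rightarrow> 'g falg set" where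
  "pcls G R f = genideal (free_algebra G) R +>\<^bsub>free_algebra G\<^esub> f"

lemma carrier_free_algebra:
  "f \<in> carrier (free_algebra G) \<longleftrightarrow> (\<forall>w \<in> Poly_Mapping.keys f. set w \<subseteq> G)"
  by (simp add: free_algebra_def)

lemma free_algebra_ops:
  "mult (free_algebra G) = (*)" "one (free_algebra G) = 1"
  "ring.zero (free_algebra G) = 0" "add (free_algebra G) = (+)"
  by (simp_all add: free_algebra_def)

lemma free_algebra_closed:
  assumes "f \<in> carrier (free_algebra G)" "g \<in> carrier (free_algebra G)"
  shows "f + g \<in> carrier (free_algebra G)" "f - g \<in> carrier (free_algebra G)"
    "f * g \<in> carrier (free_algebra G)" "- f \<in> carrier (free_algebra G)"
  using assms Poly_Mapping.keys_add[of f g] keys_diff[of f g] keys_mult[of f g]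
  by (fastforce simp: carrier_free_algebra plus_list_def)+

lemma scal_closed: "scal a \<in> carrier (free_algebra G)"
  by (simp add: carrier_free_algebra scal_def)

lemma gen_closed: "x \<in> G \<Longrightarrow> gen x \<in> carrier (free_algebra G)"
  by (simp add: carrier_free_algebra gen_def)

lemma zero_one_closed:
  "0 \<in> carrier (free_algebra G)" "1 \<in> carrier (free_algebra G)"
  by (simp_all add: carrier_free_algebra zero_list_def)

lemma sum_closed:
  "(\<And>x. x \<in> A \<Longrightarrow> f x \<in> carrier (free_algebra G)) \<Longrightarrow> sum f A \<in> carrier (free_algebra G)"
  by (induction A rule: infinite_finite_induct) (auto intro: zero_one_closed free_algebra_closed)

lemma part_closed:
  assumes "f \<in> carrier (free_algebra G)" shows "part P f \<in> carrier (free_algebra G)"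
  unfolding part_def
  by (rule sum_closed) (use assms in \<open>auto simp: carrier_free_algebra\<close>)

lemma sbracket_closed:
  assumes "f \<in> carrier (free_algebra G)" "g \<in> carrier (free_algebra G)"
  shows "sbracket odd_gen f g \<in> carrier (free_algebra G)"
  unfolding sbracket_def Let_def using assms
  by (auto intro!: sum_closed free_algebra_closed part_closed zero_one_closed)

lemma ring_free_algebra: "ring (free_algebra G)"
proof (rule ringI)
  show "abelian_group (free_algebra G)"
  proof (rule abelian_groupI)
    fix x assume "x \<in> carrier (free_algebra G)"
    then have "- x \<in> carrier (free_algebra G)"
      by (rule free_algebra_closed) (rule zero_one_closed)
    then show "\<exists>y \<in> carrier (free_algebra G). y \<oplus>\<^bsub>free_algebra G\<^esub> x = \<zero>\<^bsub>free_algebra G\<^esub>"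
      by (intro bexI[of _ "- x"]) (simp_all add: free_algebra_ops)
  qed (auto intro: free_algebra_closed zero_one_closed simp: free_algebra_ops add_ac)
  show "Group.monoid (free_algebra G)"
    by (rule monoidI) (auto intro: free_algebra_closed zero_one_closed simp: free_algebra_ops mult.assoc)
qed (simp_all add: free_algebra_ops distrib_left distrib_right)

lemma ring_presented_algebra:
  assumes "R \<subseteq> carrier (free_algebra G)"
  shows "ring (presented_algebra G R)"
  unfolding presented_algebra_def
  using assms by (intro ideal.quotient_is_ring ring.genideal_ideal ring_free_algebra)

section \<open>The affine super Yangian\<close>

definition pr :: "nat \<Rightarrow> nat \<Rightarrow> nat" where
  "pr m i = (if 1 \<le> i \<and> i \<le> m then 0 else 1)"

definition cartan_a :: "nat \<Rightarrow> nat \<Rightarrow> nat \<Rightarrow> nat \<Rightarrow> int" where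
  "cartan_a m n i j =
     (if i = j then (-1) ^ pr m i + (-1) ^ pr m (i + 1)
      else if j = i + 1 then - ((-1) ^ pr m (i + 1))
      else if i = j + 1 then - ((-1) ^ pr m i)
      else if (i = 0 \<and> j = m + n - 1) \<or> (i = m + n - 1 \<and> j = 0) then 1
      else 0)"

definition cartan_m :: "nat \<Rightarrow> nat \<Rightarrow> nat \<Rightarrow> nat \<Rightarrow> int" where
  "cartan_m m n i j =
     (if j = i + 1 then - ((-1) ^ pr m (i + 1))
      else if i = j + 1 then (-1) ^ pr m i
      else if i = 0 \<and> j = m + n - 1 then -1
      else if i = m + n - 1 \<and> j = 0 then 1
      else 0)"

datatype pm = Pl | Mi

fun sg :: "pm \<Rightarrow> complex" where
  "sg Pl = 1"
| "sg Mi = -1"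

datatype ygen = YX pm nat nat | YH nat nat

definition ygens :: "nat \<Rightarrow> nat \<Rightarrow> ygen set" where
  "ygens m n = {YX \<sigma> i r |\<sigma> i r. i < m + n} \<union> {YH i r |i r. i < m + n}"

fun yodd :: "nat \<Rightarrow> ygen \<Rightarrow> bool" where
  "yodd m (YX \<sigma> i r) \<longleftrightarrow> i = 0 \<or> i = m"
| "yodd m (YH i r) \<longleftrightarrow> False"

abbreviation yx :: "pm \<Rightarrow> nat \<Rightarrow> nat \<Rightarrow> ygen falg" where
  "yx \<sigma> i r \<equiv> gen (YX \<sigma> i r)"

abbreviation yh :: "nat \<Rightarrow> nat \<Rightarrow> ygen falg" where
  "yh i r \<equiv> gen (YH i r)"

abbreviation ybr :: "nat \<Rightarrow> ygen falg \<Rightarrow> ygen falg \<Rightarrow> ygen falg" where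
  "ybr m \<equiv> sbracket (yodd m)"

text \<open>A defining relation \<open>f = g\<close> of the Yangian is recorded as the element \<open>f - g\<close>.\<close>

inductive_set yrels :: "nat \<Rightarrow> nat \<Rightarrow> complex \<Rightarrow> complex \<Rightarrow> ygen falg set"
  for m n :: nat and \<epsilon>1 \<epsilon>2 :: complex where
  hh: "\<lbrakk>i < m + n; j < m + n\<rbrakk> \<Longrightarrow> ybr m (yh i r) (yh j s) \<in> yrels m n \<epsilon>1 \<epsilon>2"
| xx: "\<lbrakk>i < m + n; j < m + n\<rbrakk> \<Longrightarrow>
    ybr m (yx Pl i r) (yx Mi j s) - (if i = j then yh i (r + s) else 0) \<in> yrels m n \<epsilon>1 \<epsilon>2"
| h0x: "\<lbrakk>i < m + n; j < m + n\<rbrakk> \<Longrightarrow>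
    ybr m (yh i 0) (yx \<sigma> j r) - scal (sg \<sigma> * of_int (cartan_a m n i j)) * yx \<sigma> j r
      \<in> yrels m n \<epsilon>1 \<epsilon>2"
| hx: "\<lbrakk>i < m + n; j < m + n\<rbrakk> \<Longrightarrow>
    (ybr m (yh i (r + 1)) (yx \<sigma> j s) - ybr m (yh i r) (yx \<sigma> j (s + 1)))
    - (scal (sg \<sigma> * of_int (cartan_a m n i j) * ((\<epsilon>1 + \<epsilon>2) / 2)) * anticomm (yh i r) (yx \<sigma> j s)
       - scal (of_int (cartan_m m n i j) * ((\<epsilon>1 - \<epsilon>2) / 2)) * ybr m (yh i r) (yx \<sigma> j s))
      \<in> yrels m n \<epsilon>1 \<epsilon>2"
| xx_shift: "\<lbrakk>i < m + n; j < m + n\<rbrakk> \<Longrightarrow>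
    (ybr m (yx \<sigma> i (r + 1)) (yx \<sigma> j s) - ybr m (yx \<sigma> i r) (yx \<sigma> j (s + 1)))
    - (scal (sg \<sigma> * of_int (cartan_a m n i j) * ((\<epsilon>1 + \<epsilon>2) / 2)) * anticomm (yx \<sigma> i r) (yx \<sigma> j s)
       - scal (of_int (cartan_m m n i j) * ((\<epsilon>1 - \<epsilon>2) / 2)) * ybr m (yx \<sigma> i r) (yx \<sigma> j s))
      \<in> yrels m n \<epsilon>1 \<epsilon>2"
| serre: "\<lbrakk>i < m + n; j < m + n; i \<noteq> j; k = 1 + nat \<bar>cartan_a m n i j\<bar>\<rbrakk> \<Longrightarrow>
    (\<Sum>w | w permutes {1..k}.
       foldr (\<lambda>t y. ybr m (yx \<sigma> i (r (w t))) y) [1..<k + 1] (yx \<sigma> j s)) \<in> yrels m n \<epsilon>1 \<epsilon>2"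
| odd_sq: "i \<in> {0, m} \<Longrightarrow> ybr m (yx \<sigma> i r) (yx \<sigma> i s) \<in> yrels m n \<epsilon>1 \<epsilon>2"
| odd_serre: "i \<in> {0, m} \<Longrightarrow>
    ybr m (ybr m (yx \<sigma> ((i + (m + n) - 1) mod (m + n)) r) (yx \<sigma> i 0))
          (ybr m (yx \<sigma> i 0) (yx \<sigma> ((i + 1) mod (m + n)) s)) \<in> yrels m n \<epsilon>1 \<epsilon>2"

definition affine_super_yangian :: "nat \<Rightarrow> nat \<Rightarrow> complex \<Rightarrow> complex \<Rightarrow> ygen falg set ring" where
  "affine_super_yangian m n \<epsilon>1 \<epsilon>2 = presented_algebra (ygens m n) (yrels m n \<epsilon>1 \<epsilon>2)"

definition ycls :: "nat \<Rightarrow> nat \<Rightarrow> complex \<Rightarrow> complex \<Rightarrow> ygen falg \<Rightarrow> ygen falg set" where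
  "ycls m n \<epsilon>1 \<epsilon>2 = pcls (ygens m n) (yrels m n \<epsilon>1 \<epsilon>2)"

lemma yrels_closed:
  assumes "m \<ge> 1" "n \<ge> 1" shows "yrels m n \<epsilon>1 \<epsilon>2 \<subseteq> carrier (free_algebra (ygens m n))"
proof
  fix f assume "f \<in> yrels m n \<epsilon>1 \<epsilon>2"
  then show "f \<in> carrier (free_algebra (ygens m n))"
  proof induction
    case (serre i j k \<sigma> r s)
    have "foldr (\<lambda>t y. ybr m (yx \<sigma> i (r (w t))) y) ts (yx \<sigma> j s)
            \<in> carrier (free_algebra (ygens m n))" for w ts
      using serre by (induction ts) (auto intro!: sbracket_closed gen_closed simp: ygens_def)
    then show ?case by (intro sum_closed)
  qed (use assms in \<open>auto intro!: sbracket_closed free_algebra_closed scal_closed gen_closed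
         zero_one_closed simp: ygens_def anticomm_def\<close>)
qed

lemma ring_affine_super_yangian:
  "m \<ge> 1 \<Longrightarrow> n \<ge> 1 \<Longrightarrow> ring (affine_super_yangian m n \<epsilon>1 \<epsilon>2)"
  unfolding affine_super_yangian_def by (intro ring_presented_algebra yrels_closed)

section \<open>The affine Lie superalgebra and its enveloping algebra\<close>

type_synonym cmat = "nat \<Rightarrow> nat \<Rightarrow> complex"

definition munit :: "nat \<Rightarrow> nat \<Rightarrow> cmat" where
  "munit i j = (\<lambda>a b. if a = i \<and> b = j then 1 else 0)"

definition mmul :: "nat \<Rightarrow> nat \<Rightarrow> cmat \<Rightarrow> cmat \<Rightarrow> cmat" where
  "mmul m n x y = (\<lambda>a b. \<Sum>k = 1..m + n. x a k * y k b)"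

definition str :: "nat \<Rightarrow> nat \<Rightarrow> cmat \<Rightarrow> complex" where
  "str m n x = (\<Sum>a = 1..m + n. (-1) ^ pr m a * x a a)"

definition gl_bracket_units :: "nat \<Rightarrow> nat \<Rightarrow> nat \<Rightarrow> nat \<Rightarrow> nat \<Rightarrow> nat \<Rightarrow> cmat" where
  "gl_bracket_units m n i j k l =
     (\<lambda>a b. mmul m n (munit i j) (munit k l) a b
            - (-1) ^ ((pr m i + pr m j) * (pr m k + pr m l)) * mmul m n (munit k l) (munit i j) a b)"

text \<open>
  The homogeneous basis of the affine Lie superalgebra: \<open>GE i j s\<close> stands for
  \<open>E\<^bsub>i,j\<^esub> \<otimes> t\<^bsup>s\<^esup>\<close>, and \<open>GC\<close>, \<open>GZ\<close> for the central elements \<open>c\<close>, \<open>z\<close>. The Lie superalgebra itself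
  is the space of finitely supported functions on this basis.
\<close>

datatype ggen = GE nat nat int | GC | GZ

definition ggens :: "nat \<Rightarrow> nat \<Rightarrow> ggen set" where
  "ggens m n = {GE i j s |i j s. i \<in> {1..m + n} \<and> j \<in> {1..m + n}} \<union> {GC, GZ}"

fun godd :: "nat \<Rightarrow> ggen \<Rightarrow> bool" where
  "godd m (GE i j s) \<longleftrightarrow> odd (pr m i + pr m j)"
| "godd m GC \<longleftrightarrow> False"
| "godd m GZ \<longleftrightarrow> False"

definition loop :: "nat \<Rightarrow> nat \<Rightarrow> cmat \<Rightarrow> int \<Rightarrow> (ggen \<Rightarrow>\<^sub>0 complex)" where
  "loop m n x u = (\<Sum>a = 1..m + n. \<Sum>b = 1..m + n. Poly_Mapping.single (GE a b u) (x a b))"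

fun aff_bracket :: "nat \<Rightarrow> nat \<Rightarrow> ggen \<Rightarrow> ggen \<Rightarrow> (ggen \<Rightarrow>\<^sub>0 complex)" where
  "aff_bracket m n (GE i j u) (GE k l v) =
     loop m n (gl_bracket_units m n i j k l) (u + v)
     + (if u + v = 0
        then Poly_Mapping.single GC (of_int u * str m n (mmul m n (munit i j) (munit k l)))
             + Poly_Mapping.single GZ (of_int u * (str m n (munit i j) * str m n (munit k l)))
        else 0)"
| "aff_bracket m n _ _ = 0"

text \<open>Embedding of a vector space with chosen basis into its tensor algebra.\<close>

definition lin :: "('g \<Rightarrow>\<^sub>0 complex) \<Rightarrow> 'g falg" where
  "lin x = (\<Sum>g \<in> Poly_Mapping.keys x. scal (Poly_Mapping.lookup x g) * gen g)"

text \<open>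
  The enveloping algebra, with the central elements specialised to complex numbers \<open>c\<close> and \<open>z\<close>.
  The relations \<open>xy - (-1)\<^bsup>|x||y|\<^esup> yx = [x,y]\<close> in the tensor algebra are bilinear, so they are
  imposed for basis elements.
\<close>

definition urels :: "nat \<Rightarrow> nat \<Rightarrow> complex \<Rightarrow> complex \<Rightarrow> ggen falg set" where
  "urels m n c z =
     {sbracket (godd m) (gen x) (gen y) - lin (aff_bracket m n x y) |x y.
        x \<in> ggens m n \<and> y \<in> ggens m n}
     \<union> {gen GC - scal c, gen GZ - scal z}"

definition Ualg :: "nat \<Rightarrow> nat \<Rightarrow> complex \<Rightarrow> complex \<Rightarrow> ggen falg set ring" where
  "Ualg m n c z = presented_algebra (ggens m n) (urels m n c z)"

definition ucls :: "nat \<Rightarrow> nat \<Rightarrow> complex \<Rightarrow> complex \<Rightarrow> ggen falg \<Rightarrow> ggen falg set" where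
  "ucls m n c z = pcls (ggens m n) (urels m n c z)"

lemma urels_closed: "urels m n c z \<subseteq> carrier (free_algebra (ggens m n))"
proof -
  have loop: "Poly_Mapping.keys (loop m n x u) \<subseteq> ggens m n" for x u
  proof -
    have "Poly_Mapping.keys (loop m n x u) \<subseteq>
        (\<Union>a\<in>{1..m + n}. \<Union>b\<in>{1..m + n}. Poly_Mapping.keys (Poly_Mapping.single (GE a b u) (x a b)))"
      unfolding loop_def by (intro order_trans[OF keys_sum] UN_mono order_refl)
    also have "\<dots> \<subseteq> ggens m n" by (auto simp: ggens_def split: if_splits)
    finally show ?thesis .
  qed
  have "Poly_Mapping.keys (aff_bracket m n x y) \<subseteq> ggens m n" for x y
  proof (cases "(m, n, x, y)" rule: aff_bracket.cases)
    case (1 m' n' i j u k l v)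
    have "{GC, GZ} \<subseteq> ggens m n" by (simp add: ggens_def)
    then show ?thesis
      using 1 loop by (auto dest!: subsetD[OF Poly_Mapping.keys_add] split: if_splits)
  qed auto
  then have "lin (aff_bracket m n x y) \<in> carrier (free_algebra (ggens m n))" for x y
    unfolding lin_def by (intro sum_closed free_algebra_closed scal_closed gen_closed) auto
  then show ?thesis
    by (auto simp: urels_def intro!: free_algebra_closed sbracket_closed gen_closed scal_closed)
       (auto simp: ggens_def)
qed

lemma ring_Ualg: "ring (Ualg m n c z)"
  unfolding Ualg_def by (intro ring_presented_algebra urels_closed)

section \<open>The degreewise completion\<close>

fun gdeg :: "ggen \<Rightarrow> int" where
  "gdeg (GE i j s) = s"
| "gdeg GC = 0"
| "gdeg GZ = 0"

definition wdeg :: "ggen list \<Rightarrow> int" where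
  "wdeg w = sum_list (map gdeg w)"

definition Udeg :: "nat \<Rightarrow> nat \<Rightarrow> complex \<Rightarrow> complex \<Rightarrow> int \<Rightarrow> ggen falg set set" where
  "Udeg m n c z d =
     ucls m n c z ` {f \<in> carrier (free_algebra (ggens m n)). \<forall>w \<in> Poly_Mapping.keys f. wdeg w = d}"

text \<open>\<open>Jsub d N\<close> is the sum of the products \<open>U\<^bsub>d-r\<^esub> U\<^bsub>r\<^esub>\<close> over \<open>r > N\<close>.\<close>

definition Jsub :: "nat \<Rightarrow> nat \<Rightarrow> complex \<Rightarrow> complex \<Rightarrow> int \<Rightarrow> nat \<Rightarrow> ggen falg set set" where
  "Jsub m n c z d N =
     generate (add_monoid (Ualg m n c z))
       {a \<otimes>\<^bsub>Ualg m n c z\<^esub> b |a b r. r > int N \<and> a \<in> Udeg m n c z (d - r) \<and> b \<in> Udeg m n c z r}"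

definition Uquot :: "nat \<Rightarrow> nat \<Rightarrow> complex \<Rightarrow> complex \<Rightarrow> int \<Rightarrow> nat \<Rightarrow> ggen falg set set set" where
  "Uquot m n c z d N = (\<lambda>u. Jsub m n c z d N +>\<^bsub>Ualg m n c z\<^esub> u) ` Udeg m n c z d"

text \<open>
  The inverse limit in degree \<open>d\<close>. The transition map sends a coset of \<open>Jsub d N'\<close> to the unique
  coset of the larger subgroup \<open>Jsub d N\<close> (\<open>N \<le> N'\<close>) that contains it.
\<close>

definition Ulim :: "nat \<Rightarrow> nat \<Rightarrow> complex \<Rightarrow> complex \<Rightarrow> int \<Rightarrow> (nat \<Rightarrow> ggen falg set set) set" where
  "Ulim m n c z d =
     {x. (\<forall>N. x N \<in> Uquot m n c z d N) \<and> (\<forall>N N'. N \<le> N' \<longrightarrow> x N' \<subseteq> x N)}"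

definition Ulim_topology ::
  "nat \<Rightarrow> nat \<Rightarrow> complex \<Rightarrow> complex \<Rightarrow> int \<Rightarrow> (nat \<Rightarrow> ggen falg set set) topology" where
  "Ulim_topology m n c z d =
     subtopology (product_topology (\<lambda>N. discrete_topology (Uquot m n c z d N)) UNIV)
       (Ulim m n c z d)"

type_synonym ucomp = "int \<Rightarrow> nat \<Rightarrow> ggen falg set set"

text \<open>
  The direct sum of the inverse limits. In the product of \<open>x\<close> and \<open>y\<close>, the component of degree
  \<open>D\<close> modulo \<open>Jsub D N\<close> is the sum over \<open>d\<close> of \<open>x\<^bsub>d\<^esub> y\<^bsub>D-d\<^esub>\<close>. It is computed from a representative of
  \<open>y\<^bsub>D-d\<^esub>\<close> modulo \<open>Jsub (D-d) N\<close> and one of \<open>x\<^bsub>d\<^esub>\<close> modulo \<open>Jsub d M\<close> with \<open>M \<ge> N - (D - d)\<close>, because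
  \<open>(Jsub d M) U\<^bsub>e\<^esub>\<close> is contained in \<open>Jsub (d + e) (M + e)\<close>. All choices of representatives give the same
  coset; as in the library's product of cosets, the union over all choices is taken.
\<close>

definition Ucomp :: "nat \<Rightarrow> nat \<Rightarrow> complex \<Rightarrow> complex \<Rightarrow> ucomp ring" where
  "Ucomp m n c z =
     \<lparr>carrier = {x. (\<forall>d. x d \<in> Ulim m n c z d) \<and> finite {d. x d \<noteq> Jsub m n c z d}},
      mult = (\<lambda>x y D N.
        let S = {d. x d \<noteq> Jsub m n c z d} in
        \<Union>a \<in> Pi S (\<lambda>d. x d (nat (int N - (D - d)))).
        \<Union>b \<in> Pi S (\<lambda>d. y (D - d) N).
          Jsub m n c z D N +>\<^bsub>Ualg m n c z\<^esub>
            (\<Oplus>\<^bsub>Ualg m n c z\<^esub>d\<in>S. a d \<otimes>\<^bsub>Ualg m n c z\<^esub> b d)),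
      one = (\<lambda>D N. Jsub m n c z D N +>\<^bsub>Ualg m n c z\<^esub>
               (if D = 0 then \<one>\<^bsub>Ualg m n c z\<^esub> else \<zero>\<^bsub>Ualg m n c z\<^esub>)),
      ring.zero = Jsub m n c z,
      add = (\<lambda>x y D N. x D N <+>\<^bsub>Ualg m n c z\<^esub> y D N)\<rparr>"

text \<open>
  The topology of the completion: the direct sum topology of the inverse-limit topologies of the
  homogeneous components. A basis is given by the boxes of open sets, one in each degree.
\<close>

definition Ucomp_topology :: "nat \<Rightarrow> nat \<Rightarrow> complex \<Rightarrow> complex \<Rightarrow> ucomp topology" where
  "Ucomp_topology m n c z =
     topology_generated_by
       {{x \<in> carrier (Ucomp m n c z). \<forall>d. x d \<in> W d} |W.
          \<forall>d. openin (Ulim_topology m n c z d) (W d)}"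

text \<open>
  The canonical homomorphism from the free algebra on the basis, through the enveloping algebra,
  to the completion.
\<close>

definition to_comp :: "nat \<Rightarrow> nat \<Rightarrow> complex \<Rightarrow> complex \<Rightarrow> ggen falg \<Rightarrow> ucomp" where
  "to_comp m n c z f =
     (\<lambda>d N. Jsub m n c z d N +>\<^bsub>Ualg m n c z\<^esub> ucls m n c z (part (\<lambda>w. wdeg w = d) f))"

definition comp_series :: "nat \<Rightarrow> nat \<Rightarrow> complex \<Rightarrow> complex \<Rightarrow> (nat \<Rightarrow> ggen falg) \<Rightarrow> ucomp" where
  "comp_series m n c z f =
     (THE l. limitin (Ucomp_topology m n c z) (\<lambda>N. to_comp m n c z (\<Sum>s<N. f s)) l sequentially)"

section \<open>The evaluation map\<close>

abbreviation gE :: "nat \<Rightarrow> nat \<Rightarrow> int \<Rightarrow> ggen falg" where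
  "gE i j s \<equiv> gen (GE i j s)"

definition ev_h :: "nat \<Rightarrow> nat \<Rightarrow> complex \<Rightarrow> nat \<Rightarrow> ggen falg" where
  "ev_h m n c i =
     (if i = 0 then - gE 1 1 0 - gE (m + n) (m + n) 0 + scal c
      else scal ((-1) ^ pr m i) * gE i i 0 - scal ((-1) ^ pr m (i + 1)) * gE (i + 1) (i + 1) 0)"

fun ev_x :: "nat \<Rightarrow> nat \<Rightarrow> pm \<Rightarrow> nat \<Rightarrow> ggen falg" where
  "ev_x m n Pl i = (if i = 0 then gE (m + n) 1 1 else gE i (i + 1) 0)"
| "ev_x m n Mi i =
     (if i = 0 then - gE 1 (m + n) (-1) else scal ((-1) ^ pr m i) * gE (i + 1) i 0)"

definition comp_smult ::
  "nat \<Rightarrow> nat \<Rightarrow> complex \<Rightarrow> complex \<Rightarrow> complex \<Rightarrow> ucomp \<Rightarrow> ucomp" where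
  "comp_smult m n c z a x = to_comp m n c z (scal a) \<otimes>\<^bsub>Ucomp m n c z\<^esub> x"

definition ev_h01 ::
  "nat \<Rightarrow> nat \<Rightarrow> complex \<Rightarrow> complex \<Rightarrow> complex \<Rightarrow> complex \<Rightarrow> complex \<Rightarrow> ucomp" where
  "ev_h01 m n \<epsilon>1 \<epsilon>2 \<alpha> c z =
     (let h = \<epsilon>1 + \<epsilon>2; U = Ucomp m n c z; l = m + n in
        to_comp m n c z
          (scal (\<alpha> - (of_nat m - of_nat n) * \<epsilon>1) * ev_h m n c 0
           + scal h * gE l l 0 * (gE 1 1 0 - scal c))
        \<oplus>\<^bsub>U\<^esub> comp_smult m n c z (- h)
          (comp_series m n c z (\<lambda>s. \<Sum>k = 1..l.
             scal ((-1) ^ pr m k) * gE l k (- int s) * gE k l (int s)))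
        \<oplus>\<^bsub>U\<^esub> comp_smult m n c z (- h)
          (comp_series m n c z (\<lambda>s. \<Sum>k = 1..l.
             scal ((-1) ^ pr m k) * gE 1 k (- int s - 1) * gE k 1 (int s + 1))))"

definition ev_hi1 ::
  "nat \<Rightarrow> nat \<Rightarrow> complex \<Rightarrow> complex \<Rightarrow> complex \<Rightarrow> complex \<Rightarrow> complex \<Rightarrow> nat \<Rightarrow> ucomp" where
  "ev_hi1 m n \<epsilon>1 \<epsilon>2 \<alpha> c z i =
     (let h = \<epsilon>1 + \<epsilon>2; U = Ucomp m n c z; l = m + n;
          \<delta> = (if i \<ge> m + 1 then 1 else 0) in
        to_comp m n c z
          (scal (\<alpha> - (of_nat i - 2 * \<delta> * (of_nat i - of_nat m)) * \<epsilon>1) * ev_h m n c i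
           - scal ((-1) ^ (pr m i + pr m (i + 1)) * h) * gE i i 0 * gE (i + 1) (i + 1) 0)
        \<oplus>\<^bsub>U\<^esub> comp_smult m n c z (h * (-1) ^ pr m i)
          (comp_series m n c z (\<lambda>s. \<Sum>k = 1..i.
             scal ((-1) ^ pr m k) * gE i k (- int s) * gE k i (int s)))
        \<oplus>\<^bsub>U\<^esub> comp_smult m n c z (h * (-1) ^ pr m i)
          (comp_series m n c z (\<lambda>s. \<Sum>k = i + 1..l.
             scal ((-1) ^ pr m k) * gE i k (- int s - 1) * gE k i (int s + 1)))
        \<oplus>\<^bsub>U\<^esub> comp_smult m n c z (- h * (-1) ^ pr m (i + 1))
          (comp_series m n c z (\<lambda>s. \<Sum>k = 1..i.
             scal ((-1) ^ pr m k) * gE (i + 1) k (- int s) * gE k (i + 1) (int s)))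
        \<oplus>\<^bsub>U\<^esub> comp_smult m n c z (- h * (-1) ^ pr m (i + 1))
          (comp_series m n c z (\<lambda>s. \<Sum>k = i + 1..l.
             scal ((-1) ^ pr m k) * gE (i + 1) k (- int s - 1) * gE k (i + 1) (int s + 1))))"

text \<open>
  The evaluation map is the unique algebra homomorphism with the following values; the second
  conjunct expresses \<open>\<complex>\<close>-linearity.
\<close>

definition is_evaluation_map ::
  "nat \<Rightarrow> nat \<Rightarrow> complex \<Rightarrow> complex \<Rightarrow> complex \<Rightarrow> complex \<Rightarrow> complex \<Rightarrow>
     (ygen falg set \<Rightarrow> ucomp) \<Rightarrow> bool" where
  "is_evaluation_map m n \<epsilon>1 \<epsilon>2 \<alpha> c z ev \<longleftrightarrow>
     ev \<in> ring_hom (affine_super_yangian m n \<epsilon>1 \<epsilon>2) (Ucomp m n c z)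
     \<and> (\<forall>a. ev (ycls m n \<epsilon>1 \<epsilon>2 (scal a)) = to_comp m n c z (scal a))
     \<and> (\<forall>\<sigma>. \<forall>i < m + n. ev (ycls m n \<epsilon>1 \<epsilon>2 (yx \<sigma> i 0)) = to_comp m n c z (ev_x m n \<sigma> i))
     \<and> (\<forall>i < m + n. ev (ycls m n \<epsilon>1 \<epsilon>2 (yh i 0)) = to_comp m n c z (ev_h m n c i))
     \<and> ev (ycls m n \<epsilon>1 \<epsilon>2 (yh 0 1)) = ev_h01 m n \<epsilon>1 \<epsilon>2 \<alpha> c z
     \<and> (\<forall>i \<in> {1..<m + n}. ev (ycls m n \<epsilon>1 \<epsilon>2 (yh i 1)) = ev_hi1 m n \<epsilon>1 \<epsilon>2 \<alpha> c z i)"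

end

theory Submission
  imports Defs
begin

text \<open>
  The image \<open>A\<close> of the evaluation map contains the Chevalley generators, hence all \<open>E\<^bsub>a,b\<^esub>(s)\<close> with
  \<open>a \<noteq> b\<close> and all \<open>E\<^bsub>1,1\<^esub>(s) - E\<^bsub>2,2\<^esub>(s)\<close>. Removing products of such elements from \<open>ev h\<^bsub>1,1\<^esub>\<close> and
  dividing by \<open>\<epsilon>1 + \<epsilon>2\<close> shows that the closure of \<open>A\<close> contains
  \<open>V = \<Sum>\<^sub>s E\<^bsub>1,1\<^esub>(-s) E\<^bsub>1,1\<^esub>(s) - \<Sum>\<^sub>s E\<^bsub>2,2\<^esub>(-s-1) E\<^bsub>2,2\<^esub>(s+1) - E\<^bsub>1,1\<^esub> E\<^bsub>2,2\<^esub>\<close>, summed over \<open>s \<ge> 0\<close>.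
  The commutator of \<open>V\<close> with \<open>E\<^bsub>1,1\<^esub>(u) - E\<^bsub>2,2\<^esub>(u)\<close>, \<open>u \<noteq> 0\<close>, is \<open>-u c (E\<^bsub>1,1\<^esub>(u) + E\<^bsub>2,2\<^esub>(u))\<close>, so
  \<open>c \<noteq> 0\<close> gives \<open>E\<^bsub>1,1\<^esub>(u)\<close> for \<open>u \<noteq> 0\<close>. Up to elements already obtained, what is left of \<open>V\<close> is
  \<open>E\<^bsub>1,1\<^esub> (E\<^bsub>1,1\<^esub> - E\<^bsub>2,2\<^esub>)\<close>; commuting it with \<open>E\<^bsub>1,2\<^esub>(1)\<close> yields \<open>E\<^bsub>1,1\<^esub> E\<^bsub>1,2\<^esub>(1)\<close>, and commuting this
  with \<open>E\<^bsub>2,1\<^esub>(-1)\<close> yields \<open>c E\<^bsub>1,1\<^esub>\<close>.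
  Both \<open>c \<noteq> 0\<close> and \<open>\<epsilon>1 + \<epsilon>2 \<noteq> 0\<close> follow from \<open>(\<epsilon>1 + \<epsilon>2) c = (n - m) \<epsilon>1\<close>, \<open>m \<noteq> n\<close> and \<open>\<epsilon>1 \<noteq> 0\<close>.
\<close>

section \<open>Computations in free algebras\<close>

lemma sum_single_lookup:
  "(\<Sum>w \<in> Poly_Mapping.keys f. Poly_Mapping.single w (Poly_Mapping.lookup f w)) = f"
  by (rule poly_mapping_eqI) (auto simp: lookup_sum lookup_single when_def in_keys_iff sum.delta)

lemma scal_zero: "scal 0 = 0"
  by (simp add: scal_def)

lemma scal_one: "scal 1 = 1"
  by (simp add: scal_def flip: zero_list_def)

lemma scal_add: "scal (a + b) = scal a + scal b"
  by (simp add: scal_def Poly_Mapping.single_add)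

lemma scal_uminus: "scal (- a) = - scal a"
  by (simp add: scal_def Poly_Mapping.single_uminus)

lemma scal_diff: "scal (a - b) = scal a - scal b"
  by (simp add: scal_def Poly_Mapping.single_diff)

lemma scal_mult: "scal (a * b) = scal a * scal b"
  by (simp add: scal_def mult_single plus_list_def)

lemma scal_single: "scal a * Poly_Mapping.single w b = Poly_Mapping.single w (a * b)"
  by (simp add: scal_def mult_single plus_list_def)

lemma single_scal: "Poly_Mapping.single w b * scal a = Poly_Mapping.single w (a * b)"
  by (simp add: scal_def mult_single plus_list_def mult.commute)

lemma scal_comm: "f * scal a = scal a * f"
proof -
  have "f = (\<Sum>w \<in> Poly_Mapping.keys f. Poly_Mapping.single w (Poly_Mapping.lookup f w))"
    by (rule sum_single_lookup[symmetric])
  then show ?thesis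
    by (metis (no_types, lifting) scal_single single_scal sum.cong sum_distrib_left sum_distrib_right)
qed

lemma scal_two_mult: "scal 2 * f = f + (f :: 'g falg)"
proof -
  have "(scal 2 :: 'g falg) = scal 1 + scal 1" by (simp flip: scal_add)
  then show ?thesis by (simp add: scal_one mult_2)
qed

lemma part_gen: "part P (gen x) = (if P [x] then gen x else 0)"
proof -
  have "{w \<in> Poly_Mapping.keys (gen x). P w} = (if P [x] then {[x]} else {})"
    by (auto simp: gen_def)
  then show ?thesis by (simp add: part_def gen_def)
qed

text \<open>A generator is purely even or purely odd, so only one of the four parity components in
  \<open>sbracket\<close> is nonzero.\<close>

lemma sbracket_gen:
  "sbracket odd_gen (gen x) (gen y) =
     gen x * gen y - scal (if odd_gen x \<and> odd_gen y then -1 else 1) * (gen y * gen x)"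
  by (auto simp: sbracket_def Let_def UNIV_bool part_gen word_odd_def scal_one scal_uminus)

section \<open>Brackets of matrix units, written in the free algebra\<close>

lemma lin_superset:
  assumes "finite S" "Poly_Mapping.keys x \<subseteq> S"
  shows "lin x = (\<Sum>g\<in>S. scal (Poly_Mapping.lookup x g) * gen g)"
  unfolding lin_def
  using assms by (intro sum.mono_neutral_left) (auto simp: in_keys_iff scal_zero)

lemma lin_add: "lin (x + y) = lin x + lin y"
proof -
  let ?S = "Poly_Mapping.keys x \<union> Poly_Mapping.keys y"
  have "Poly_Mapping.keys (x + y) \<subseteq> ?S" by (rule Poly_Mapping.keys_add)
  then show ?thesis
    by (simp add: lin_superset[of ?S] lookup_add scal_add distrib_right sum.distrib)
qed

lemma lin_zero: "lin 0 = 0"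
  by (simp add: lin_def)

lemma lin_single: "lin (Poly_Mapping.single g a) = scal a * gen g"
  using lin_superset[of "{g}" "Poly_Mapping.single g a"] by simp

lemma lin_sum: "lin (sum f A) = (\<Sum>x\<in>A. lin (f x))"
  by (induction A rule: infinite_finite_induct) (simp_all add: lin_zero lin_add)

lemma lin_loop:
  "lin (loop m n x u) = (\<Sum>a = 1..m + n. \<Sum>b = 1..m + n. scal (x a b) * gE a b u)"
  by (simp add: loop_def lin_sum lin_single)

lemma lin_loop_munit:
  assumes "i \<in> {1..m + n}" "j \<in> {1..m + n}"
  shows "lin (loop m n (munit i j) u) = gE i j u"
proof -
  have "scal (munit i j a b) * gE a b u = (if b = j then if a = i then gE i j u else 0 else 0)" for a b
    by (simp add: munit_def scal_one scal_zero)
  then show ?thesis using assms by (simp add: lin_loop)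
qed

lemma mmul_munit:
  assumes "j \<in> {1..m + n}"
  shows "mmul m n (munit i j) (munit k l) = (\<lambda>a b. if j = k then munit i l a b else 0)"
proof (intro ext)
  fix a b
  have "munit i j a q * munit k l q b = (if q = j then if j = k then munit i l a b else 0 else 0)" for q
    by (auto simp: munit_def)
  then show "mmul m n (munit i j) (munit k l) a b = (if j = k then munit i l a b else 0)"
    using assms by (simp add: mmul_def)
qed

lemma str_munit:
  assumes "i \<in> {1..m + n}"
  shows "str m n (munit i j) = (if i = j then (-1) ^ pr m i else 0)"
proof -
  have "(-1) ^ pr m a * munit i j a a = (if a = i then if i = j then (-1) ^ pr m i else 0 else 0)" for a
    by (auto simp: munit_def)
  then show ?thesis using assms by (simp add: str_def)
qed

lemma str_zero: "str m n (\<lambda>a b. 0) = 0"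
  by (simp add: str_def)

lemma str_mmul_munit:
  assumes "i \<in> {1..m + n}" "j \<in> {1..m + n}"
  shows "str m n (mmul m n (munit i j) (munit k l)) = (if j = k \<and> i = l then (-1) ^ pr m i else 0)"
  using assms str_munit[of i m n l] by (cases "j = k") (simp_all add: mmul_munit str_zero)

lemma lin_loop_bracket:
  assumes "i \<in> {1..m + n}" "j \<in> {1..m + n}" "k \<in> {1..m + n}" "l \<in> {1..m + n}"
  shows "lin (loop m n (gl_bracket_units m n i j k l) u) =
     (if j = k then gE i l u else 0)
     - scal ((-1) ^ ((pr m i + pr m j) * (pr m k + pr m l))) * (if l = i then gE k j u else 0)"
proof -
  let ?s = "(-1) ^ ((pr m i + pr m j) * (pr m k + pr m l)) :: complex"
  have "lin (loop m n (gl_bracket_units m n i j k l) u) =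
     lin (loop m n (mmul m n (munit i j) (munit k l)) u)
     - scal ?s * lin (loop m n (mmul m n (munit k l) (munit i j)) u)"
    by (simp add: lin_loop gl_bracket_units_def scal_diff scal_mult left_diff_distrib sum_subtractf
        sum_distrib_left mult.assoc)
  also have "lin (loop m n (mmul m n (munit i j) (munit k l)) u) = (if j = k then gE i l u else 0)"
    using assms lin_loop_munit[of i m n l u] by (simp add: mmul_munit) (simp add: lin_loop scal_zero)
  also have "lin (loop m n (mmul m n (munit k l) (munit i j)) u) = (if l = i then gE k j u else 0)"
    using assms lin_loop_munit[of k m n j u] by (simp add: mmul_munit) (simp add: lin_loop scal_zero)
  finally show ?thesis .
qed

text \<open>The supercommutator of \<open>E_ij(u)\<close> and \<open>E_kl(v)\<close> in
  \<open>U\<close>, with the central generators already replaced by the numbers \<open>c\<close> and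
  \<open>z\<close>. The two summands in the last scalar are the two supertrace terms of the
  cocycle.\<close>

definition bracket_value ::
  "nat \<Rightarrow> complex \<Rightarrow> complex \<Rightarrow> nat \<Rightarrow> nat \<Rightarrow> int \<Rightarrow> nat \<Rightarrow> nat \<Rightarrow> int \<Rightarrow> ggen falg" where
  "bracket_value m c z i j u k l v =
     (if j = k then gE i l (u + v) else 0)
     - scal ((-1) ^ ((pr m i + pr m j) * (pr m k + pr m l))) * (if l = i then gE k j (u + v) else 0)
     + (if u + v = 0 then
          scal (of_int u * (if j = k \<and> i = l then (-1) ^ pr m i else 0) * c
              + of_int u * (if i = j \<and> k = l then (-1) ^ pr m i * (-1) ^ pr m k else 0) * z)
        else 0)"

lemma pcls_closed: "f \<in> carrier (free_algebra G) \<Longrightarrow> pcls G R f \<in> carrier (presented_algebra G R)"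
  by (auto simp: presented_algebra_def FactRing_def A_RCOSETS_def' pcls_def)

text \<open>The product in \<open>Ucomp\<close> is a union over all choices of representatives; this
  collapses it once every choice gives the same coset.\<close>

lemma UN2_constant:
  assumes "A \<noteq> {}" "B \<noteq> {}" "\<And>a b. a \<in> A \<Longrightarrow> b \<in> B \<Longrightarrow> P a b = C"
  shows "(\<Union>a\<in>A. \<Union>b\<in>B. P a b) = C"
  using assms by fastforce

section \<open>The enveloping algebra and its filtration\<close>

locale affine_gl =
  fixes m n :: nat and c z :: complex
begin

abbreviation F where "F \<equiv> free_algebra (ggens m n)"
abbreviation U where "U \<equiv> Ualg m n c z"
abbreviation cl where "cl \<equiv> ucls m n c z"
abbreviation J where "J \<equiv> Jsub m n c z"

sublocale U: ring U
  by (rule ring_Ualg)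

lemma ideal_urels: "ideal (genideal F (urels m n c z)) F"
  by (rule ring.genideal_ideal[OF ring_free_algebra urels_closed])

lemma cl_hom: "cl \<in> ring_hom F U"
  using ideal.rcos_ring_hom[OF ideal_urels]
  by (simp add: ucls_def [abs_def] pcls_def [abs_def] Ualg_def presented_algebra_def)

lemma carrier_U: "carrier U = cl ` carrier F"
  by (auto simp: Ualg_def presented_algebra_def FactRing_def A_RCOSETS_def' ucls_def pcls_def)

lemma cl_closed: "f \<in> carrier F \<Longrightarrow> cl f \<in> carrier U"
  by (simp add: carrier_U)

lemma cl_add: "f \<in> carrier F \<Longrightarrow> g \<in> carrier F \<Longrightarrow> cl (f + g) = cl f \<oplus>\<^bsub>U\<^esub> cl g"
  using ring_hom_add[OF cl_hom] by (simp add: free_algebra_ops)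

lemma cl_mult: "f \<in> carrier F \<Longrightarrow> g \<in> carrier F \<Longrightarrow> cl (f * g) = cl f \<otimes>\<^bsub>U\<^esub> cl g"
  using ring_hom_mult[OF cl_hom] by (simp add: free_algebra_ops)

lemma cl_zero: "cl 0 = \<zero>\<^bsub>U\<^esub>"
  using cl_add[of 0 0] cl_closed[of 0] zero_one_closed(1)[of "ggens m n"]
  by (metis U.add.l_cancel_one' add_0)

lemma cl_minus: "f \<in> carrier F \<Longrightarrow> cl (- f) = \<ominus>\<^bsub>U\<^esub> cl f"
  using cl_add[of f "- f"] cl_closed[of f] cl_closed[of "- f"] free_algebra_closed(4)[of f]
  by (metis U.minus_equality U.a_comm add.right_inverse cl_zero)

lemma cl_diff:
  "f \<in> carrier F \<Longrightarrow> g \<in> carrier F \<Longrightarrow> cl (f - g) = cl f \<ominus>\<^bsub>U\<^esub> cl g"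
  using cl_add[of f "- g"] by (simp add: free_algebra_closed cl_minus a_minus_def)

lemma cl_eq_0: assumes "f \<in> urels m n c z" shows "cl f = \<zero>\<^bsub>U\<^esub>"
proof -
  interpret I: ideal "genideal F (urels m n c z)" F by (rule ideal_urels)
  have "f \<in> genideal F (urels m n c z)"
    using assms ring.genideal_self[OF ring_free_algebra urels_closed[of m n c z]] by auto
  then have "cl f = genideal F (urels m n c z)"
    unfolding ucls_def pcls_def by (rule I.a_rcos_const)
  then show ?thesis
    by (simp add: Ualg_def presented_algebra_def FactRing_def)
qed

text \<open>Homogeneous lifts. Degrees are read off words here, so calculations take place in the
  free algebra and are pushed to \<open>U\<close> by \<open>cl\<close> afterwards.\<close>

definition Fdeg :: "int \<Rightarrow> ggen falg set" where
  "Fdeg d = {f \<in> carrier F. \<forall>w \<in> Poly_Mapping.keys f. wdeg w = d}"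

lemma Udeg_eq: "Udeg m n c z d = cl ` Fdeg d"
  by (simp add: Udeg_def Fdeg_def)

lemma Fdeg_carrier: "f \<in> Fdeg d \<Longrightarrow> f \<in> carrier F"
  by (simp add: Fdeg_def)

lemma wdeg_append: "wdeg (v @ w) = wdeg v + wdeg w"
  by (simp add: wdeg_def)

lemma Fdeg_add: "f \<in> Fdeg d \<Longrightarrow> g \<in> Fdeg d \<Longrightarrow> f + g \<in> Fdeg d"
  using Poly_Mapping.keys_add[of f g] by (fastforce simp: Fdeg_def free_algebra_closed)

lemma Fdeg_minus: "f \<in> Fdeg d \<Longrightarrow> - f \<in> Fdeg d"
  by (auto simp: Fdeg_def free_algebra_closed)

lemma Fdeg_diff: "f \<in> Fdeg d \<Longrightarrow> g \<in> Fdeg d \<Longrightarrow> f - g \<in> Fdeg d"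
  using Fdeg_add[of f d "- g"] Fdeg_minus[of g d] by simp

lemma Fdeg_mult: "f \<in> Fdeg d \<Longrightarrow> g \<in> Fdeg e \<Longrightarrow> f * g \<in> Fdeg (d + e)"
  using Poly_Mapping.keys_mult[of f g]
  by (fastforce simp: Fdeg_def free_algebra_closed plus_list_def wdeg_append)

lemma Fdeg_zero: "0 \<in> Fdeg d"
  by (simp add: Fdeg_def zero_one_closed)

lemma Fdeg_scal: "scal a \<in> Fdeg 0"
  by (simp add: Fdeg_def scal_closed) (simp add: scal_def wdeg_def)

lemma Fdeg_scal_mult: "f \<in> Fdeg d \<Longrightarrow> scal a * f \<in> Fdeg d"
  using Fdeg_mult[OF Fdeg_scal] by simp

lemma Fdeg_gen: "x \<in> ggens m n \<Longrightarrow> gen x \<in> Fdeg (gdeg x)"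
  by (simp add: Fdeg_def gen_closed) (simp add: gen_def wdeg_def)

lemma Fdeg_sum: "(\<And>x. x \<in> A \<Longrightarrow> f x \<in> Fdeg d) \<Longrightarrow> sum f A \<in> Fdeg d"
  by (induction A rule: infinite_finite_induct) (auto intro: Fdeg_zero Fdeg_add)

section \<open>The subgroups \<open>J d N\<close> and their behaviour under multiplication\<close>

abbreviation products :: "int \<Rightarrow> nat \<Rightarrow> ggen falg set set" where
  "products d N \<equiv> {a \<otimes>\<^bsub>U\<^esub> b |a b r. r > int N \<and> a \<in> Udeg m n c z (d - r) \<and> b \<in> Udeg m n c z r}"

lemma Udeg_closed: "u \<in> Udeg m n c z d \<Longrightarrow> u \<in> carrier U"
  by (auto simp: Udeg_eq cl_closed Fdeg_carrier)

lemma Udeg_mult: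
  "u \<in> Udeg m n c z d \<Longrightarrow> v \<in> Udeg m n c z e \<Longrightarrow> u \<otimes>\<^bsub>U\<^esub> v \<in> Udeg m n c z (d + e)"
  by (auto simp: Udeg_eq Fdeg_carrier Fdeg_mult simp flip: cl_mult)

lemma Udeg_add:
  "u \<in> Udeg m n c z d \<Longrightarrow> v \<in> Udeg m n c z d \<Longrightarrow> u \<oplus>\<^bsub>U\<^esub> v \<in> Udeg m n c z d"
  by (auto simp: Udeg_eq Fdeg_carrier Fdeg_add simp flip: cl_add)

lemma Udeg_minus: "u \<in> Udeg m n c z d \<Longrightarrow> \<ominus>\<^bsub>U\<^esub> u \<in> Udeg m n c z d"
  by (auto simp: Udeg_eq Fdeg_carrier Fdeg_minus simp flip: cl_minus)

lemma Udeg_zero: "\<zero>\<^bsub>U\<^esub> \<in> Udeg m n c z d"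
  unfolding Udeg_eq by (metis Fdeg_zero cl_zero image_iff)

lemma products_subset: "products d N \<subseteq> Udeg m n c z d"
  using Udeg_mult[where d = "d - r" and e = r for r] by fastforce

lemma additive_subgroup_J: "additive_subgroup (J d N) U"
proof -
  have "products d N \<subseteq> carrier U"
    using products_subset Udeg_closed by blast
  then show ?thesis
    unfolding Jsub_def by (intro additive_subgroupI U.add.generate_is_subgroup) auto
qed

text \<open>\<open>generate\<close> views the additive group multiplicatively and inverts single
  generators only; this restates its induction with the operations of the ring.\<close>

lemma J_induct [consumes 1, case_names zero prod minus add]:
  assumes "u \<in> J d N"
    and "P \<zero>\<^bsub>U\<^esub>"
    and "\<And>a b r. r > int N \<Longrightarrow> a \<in> Udeg m n c z (d - r) \<Longrightarrow> b \<in> Udeg m n c z r \<Longrightarrow> P (a \<otimes>\<^bsub>U\<^esub> b)"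
    and "\<And>u. u \<in> J d N \<Longrightarrow> P u \<Longrightarrow> P (\<ominus>\<^bsub>U\<^esub> u)"
    and "\<And>u v. u \<in> J d N \<Longrightarrow> v \<in> J d N \<Longrightarrow> P u \<Longrightarrow> P v \<Longrightarrow> P (u \<oplus>\<^bsub>U\<^esub> v)"
  shows "P u"
  using assms(1) unfolding Jsub_def
proof induction
  case one
  then show ?case using assms(2) by simp
next
  case (incl h)
  then show ?case using assms(3) by blast
next
  case (inv h)
  then have "P h" "h \<in> J d N" using assms(3) unfolding Jsub_def by (blast, blast intro: generate.incl)
  then show ?case using assms(4) by (simp add: a_inv_def)
next
  case (eng h1 h2)
  then show ?case using assms(5) unfolding Jsub_def by simp
qed

lemma J_zero: "\<zero>\<^bsub>U\<^esub> \<in> J d N"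
  by (rule additive_subgroup.zero_closed[OF additive_subgroup_J])

lemma J_add: "u \<in> J d N \<Longrightarrow> v \<in> J d N \<Longrightarrow> u \<oplus>\<^bsub>U\<^esub> v \<in> J d N"
  by (rule additive_subgroup.a_closed[OF additive_subgroup_J])

lemma J_minus: "u \<in> J d N \<Longrightarrow> \<ominus>\<^bsub>U\<^esub> u \<in> J d N"
  by (rule additive_subgroup.a_inv_closed[OF additive_subgroup_J])

lemma J_prod:
  "r > int N \<Longrightarrow> a \<in> Udeg m n c z (d - r) \<Longrightarrow> b \<in> Udeg m n c z r \<Longrightarrow> a \<otimes>\<^bsub>U\<^esub> b \<in> J d N"
  unfolding Jsub_def by (rule generate.incl) blast

lemma J_Udeg: "u \<in> J d N \<Longrightarrow> u \<in> Udeg m n c z d"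
proof (induction rule: J_induct)
  case (prod a b r)
  then show ?case using products_subset by blast
qed (auto intro: Udeg_zero Udeg_minus Udeg_add)

lemma J_closed: "u \<in> J d N \<Longrightarrow> u \<in> carrier U"
  using J_Udeg Udeg_closed by blast

lemma J_mono: "N \<le> N' \<Longrightarrow> u \<in> J d N' \<Longrightarrow> u \<in> J d N"
proof (rotate_tac, induction rule: J_induct)
  case (prod a b r)
  then show ?case by (intro J_prod[of N r]) auto
qed (auto intro: J_zero J_minus J_add)

text \<open>A factor on the left is absorbed by the left factor of each product, so the level stays
  the same.\<close>

lemma J_lmult: "u \<in> J e N \<Longrightarrow> a \<in> Udeg m n c z d \<Longrightarrow> a \<otimes>\<^bsub>U\<^esub> u \<in> J (d + e) N"
proof (induction rule: J_induct)
  case (prod b b' r)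
  then have "(a \<otimes>\<^bsub>U\<^esub> b) \<otimes>\<^bsub>U\<^esub> b' \<in> J (d + e) N"
    using Udeg_mult[of a d b "e - r"] by (intro J_prod) (auto simp: algebra_simps)
  then show ?case using prod by (simp add: U.m_assoc Udeg_closed)
next
  case (minus u)
  then show ?case using J_minus by (simp add: U.r_minus Udeg_closed J_closed)
qed (auto simp: U.r_distr Udeg_closed J_closed intro: J_zero J_add)

text \<open>A right factor of degree \<open>e\<close> turns right factors of degree
  \<open>r > M\<close> into ones of degree \<open>r + e > M + e\<close>. This asymmetry governs the
  levels in all products below.\<close>

lemma J_rmult:
  "u \<in> J d M \<Longrightarrow> b \<in> Udeg m n c z e \<Longrightarrow> int N \<le> int M + e \<Longrightarrow> u \<otimes>\<^bsub>U\<^esub> b \<in> J (d + e) N"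
proof (induction rule: J_induct)
  case (prod a a' r)
  then have "a \<otimes>\<^bsub>U\<^esub> (a' \<otimes>\<^bsub>U\<^esub> b) \<in> J (d + e) N"
    using Udeg_mult[of a' r b e] by (intro J_prod[of N "r + e"]) auto
  then show ?case using prod by (simp add: U.m_assoc Udeg_closed)
next
  case (minus u)
  then show ?case using J_minus by (simp add: U.l_minus Udeg_closed J_closed)
qed (auto simp: U.l_distr Udeg_closed J_closed intro: J_zero J_add)

text \<open>Lifts of \<open>J d N\<close>. They contain every element of \<open>Fdeg d\<close> that
  vanishes in \<open>U\<close>, so congruence modulo \<open>K d N\<close> decides equality of
  cosets.\<close>

definition K :: "int \<Rightarrow> nat \<Rightarrow> ggen falg set" where
  "K d N = {f \<in> Fdeg d. cl f \<in> J d N}"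

lemma K_Fdeg: "f \<in> K d N \<Longrightarrow> f \<in> Fdeg d"
  by (simp add: K_def)

lemma K_zero: "0 \<in> K d N"
  by (simp add: K_def Fdeg_zero cl_zero J_zero)

lemma K_add: "f \<in> K d N \<Longrightarrow> g \<in> K d N \<Longrightarrow> f + g \<in> K d N"
  by (auto simp: K_def Fdeg_add Fdeg_carrier cl_add J_add)

lemma K_minus: "f \<in> K d N \<Longrightarrow> - f \<in> K d N"
  by (auto simp: K_def Fdeg_minus Fdeg_carrier cl_minus J_minus)

lemma K_sum: "(\<And>x. x \<in> A \<Longrightarrow> f x \<in> K d N) \<Longrightarrow> sum f A \<in> K d N"
  by (induction A rule: infinite_finite_induct) (auto intro: K_zero K_add)

lemma K_prod: "f \<in> Fdeg (d - r) \<Longrightarrow> g \<in> Fdeg r \<Longrightarrow> r > int N \<Longrightarrow> f * g \<in> K d N"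
  using Fdeg_mult[of f "d - r" g r]
  by (auto simp: K_def cl_mult Fdeg_carrier Udeg_eq intro!: J_prod)

lemma K_lmult: "g \<in> K e N \<Longrightarrow> f \<in> Fdeg d \<Longrightarrow> f * g \<in> K (d + e) N"
  by (auto simp: K_def cl_mult Fdeg_carrier Udeg_eq Fdeg_mult intro!: J_lmult)

lemma K_rmult: "f \<in> K d M \<Longrightarrow> g \<in> Fdeg e \<Longrightarrow> int N \<le> int M + e \<Longrightarrow> f * g \<in> K (d + e) N"
  by (auto simp: K_def cl_mult Fdeg_carrier Udeg_eq Fdeg_mult intro!: J_rmult)

section \<open>Cosets described by representatives in the free algebra\<close>

abbreviation coset :: "int \<Rightarrow> nat \<Rightarrow> ggen falg \<Rightarrow> ggen falg set set" where
  "coset d N f \<equiv> J d N +>\<^bsub>U\<^esub> cl f"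

text \<open>Elements of \<open>J d N\<close> are homogeneous of degree \<open>d\<close>, hence each
  of them has a lift in \<open>K d N\<close>.\<close>

lemma coset_eq: "f \<in> Fdeg d \<Longrightarrow> coset d N f = {cl (k + f) |k. k \<in> K d N}"
proof -
  assume f: "f \<in> Fdeg d"
  have "\<exists>k. k \<in> K d N \<and> u \<oplus>\<^bsub>U\<^esub> cl f = cl (k + f)" if "u \<in> J d N" for u
    using that J_Udeg[OF that] f
    by (auto simp: K_def Udeg_eq cl_add Fdeg_carrier)
  moreover have "cl (k + f) = cl k \<oplus>\<^bsub>U\<^esub> cl f \<and> cl k \<in> J d N" if "k \<in> K d N" for k
    using that f by (auto simp: K_def cl_add Fdeg_carrier)
  ultimately show ?thesis
    by (fastforce simp: a_r_coset_def r_coset_def)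
qed

lemma coset_self: "f \<in> Fdeg d \<Longrightarrow> cl f \<in> coset d N f"
  by (auto simp: coset_eq intro!: exI[of _ 0] K_zero)

lemma coset_eq_iff:
  assumes "f \<in> Fdeg d" "g \<in> Fdeg d"
  shows "coset d N f = coset d N g \<longleftrightarrow> f - g \<in> K d N"
proof
  assume "coset d N f = coset d N g"
  then obtain k where k: "k \<in> K d N" "cl f = cl (k + g)"
    using coset_self[OF assms(1), of N] coset_eq[OF assms(2), of N] by auto
  then have "cl (f - g) = cl k"
    using Fdeg_carrier[OF assms(1)] Fdeg_carrier[OF assms(2)] Fdeg_carrier[OF K_Fdeg[OF k(1)]]
      cl_add[of f "- g"] cl_add[of "k + g" "- g"]
    by (simp add: free_algebra_closed)
  then show "f - g \<in> K d N"
    using k assms by (simp add: K_def Fdeg_diff)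
next
  assume fg: "f - g \<in> K d N"
  have "coset d N a \<subseteq> coset d N b" if "a - b \<in> K d N" "a \<in> Fdeg d" "b \<in> Fdeg d" for a b
  proof -
    have "\<exists>k'. cl (k + a) = cl (k' + b) \<and> k' \<in> K d N" if "k \<in> K d N" for k
      using K_add[OF that \<open>a - b \<in> K d N\<close>] by (intro exI[of _ "k + (a - b)"]) simp
    then show ?thesis using that by (auto simp: coset_eq)
  qed
  from this[of f g] this[of g f] show "coset d N f = coset d N g"
    using fg K_minus[OF fg] assms by simp
qed

lemma coset_zero: "coset d N 0 = J d N"
  by (simp add: cl_zero U.a_coset_add_zero subsetI J_closed)

subsection \<open>Levels of the completion\<close>

lemma Uquot_eq: "Uquot m n c z d N = coset d N ` Fdeg d"
  by (auto simp: Uquot_def Udeg_eq)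

lemma Ulim_obtain:
  assumes "y \<in> Ulim m n c z d"
  obtains f where "f \<in> Fdeg d" "y N = coset d N f"
proof -
  have "y N \<in> coset d N ` Fdeg d" using assms by (simp add: Ulim_def Uquot_eq)
  then show ?thesis using that by blast
qed

text \<open>Transition maps are encoded as inclusions of cosets: a representative at level
  \<open>N\<close> lies in the coset at the lower level \<open>M\<close> and so represents that one
  too.\<close>

lemma Ulim_level_mono:
  assumes "y \<in> Ulim m n c z d" "f \<in> Fdeg d" "y N = coset d N f" "M \<le> N"
  shows "y M = coset d M f"
proof -
  obtain g where g: "g \<in> Fdeg d" "y M = coset d M g"
    using Ulim_obtain[OF assms(1)] .
  have "cl f \<in> coset d M g"
    using assms(1,3,4) coset_self[OF assms(2), of N] g(2) unfolding Ulim_def by blast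
  then obtain k where k: "k \<in> K d M" "cl f = cl (k + g)"
    using g coset_eq by auto
  \<comment> \<open>Equality in \<open>U\<close> only says that the lifts differ by an element of
    the kernel of \<open>cl\<close>; that element lies in \<open>K d M\<close>.\<close>
  have "cl (f - (k + g)) = \<zero>\<^bsub>U\<^esub>"
    using k(2) Fdeg_carrier[OF assms(2)] Fdeg_carrier[OF Fdeg_add[OF K_Fdeg[OF k(1)] g(1)]]
    by (simp add: cl_diff cl_closed)
  then have "f - (k + g) \<in> K d M"
    using assms(2) g(1) K_Fdeg[OF k(1)] by (simp add: K_def Fdeg_diff Fdeg_add J_zero)
  from K_add[OF this k(1)] have "f - g \<in> K d M" by (simp add: algebra_simps)
  then show ?thesis using coset_eq_iff[OF assms(2) g(1), of M] g(2) by simp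
qed

lemma Ulim_level_eq:
  assumes "x \<in> Ulim m n c z d" "y \<in> Ulim m n c z d" "y N = x N" "M \<le> N"
  shows "y M = x M"
  using Ulim_obtain[OF assms(1), of N] Ulim_level_mono assms by metis

lemma J_Ulim: "J d \<in> Ulim m n c z d"
  using J_mono coset_zero Fdeg_zero unfolding Ulim_def Uquot_eq by blast

text \<open>No compatibility between levels is demanded, so sums and products stay homogeneous
  without an argument about inverse limits. Where compatibility matters, it comes from membership in
  the carrier.\<close>

definition homog :: "int \<Rightarrow> ucomp \<Rightarrow> bool" where
  "homog d y \<longleftrightarrow> (\<forall>e. e \<noteq> d \<longrightarrow> y e = J e) \<and> (\<forall>N. y d N \<in> Uquot m n c z d N)"

text \<open>\<open>f\<close> represents \<open>y\<close> at the single level \<open>N\<close>; other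
  levels may require other representatives.\<close>

definition rep :: "ucomp \<Rightarrow> int \<Rightarrow> nat \<Rightarrow> ggen falg \<Rightarrow> bool" where
  "rep y d N f \<longleftrightarrow> homog d y \<and> f \<in> Fdeg d \<and> y d N = coset d N f"

lemma rep_cong: "rep y d N f \<Longrightarrow> g \<in> Fdeg d \<Longrightarrow> f - g \<in> K d N \<Longrightarrow> rep y d N g"
  using coset_eq_iff by (auto simp: rep_def)

lemma homog_obtain:
  assumes "homog d y" obtains f where "rep y d N f"
proof -
  have "y d N \<in> coset d N ` Fdeg d" using assms by (simp add: homog_def Uquot_eq)
  then show ?thesis using that assms by (auto simp: rep_def)
qed

section \<open>Arithmetic of the completion on homogeneous elements\<close>

lemma part_homogeneous:
  assumes "f \<in> Fdeg d"
  shows "part (\<lambda>w. wdeg w = e) f = (if e = d then f else 0)"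
proof (cases "e = d")
  case True
  then have "{w \<in> Poly_Mapping.keys f. wdeg w = e} = Poly_Mapping.keys f"
    using assms by (auto simp: Fdeg_def)
  then show ?thesis using True by (simp add: part_def sum_single_lookup)
next
  case False
  then have "{w \<in> Poly_Mapping.keys f. wdeg w = e} = {}"
    using assms by (auto simp: Fdeg_def)
  then show ?thesis using False by (simp add: part_def del: Collect_empty_eq)
qed

lemma to_comp_eq:
  "f \<in> Fdeg d \<Longrightarrow> to_comp m n c z f e N = (if e = d then coset d N f else J e N)"
  by (simp add: to_comp_def part_homogeneous coset_zero)

lemma rep_to_comp: "f \<in> Fdeg d \<Longrightarrow> rep (to_comp m n c z f) d N f"
  by (auto simp: rep_def homog_def to_comp_eq Uquot_eq)

lemma carrier_Ucomp:
  "x \<in> carrier (Ucomp m n c z) \<longleftrightarrow>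
     (\<forall>d. x d \<in> Ulim m n c z d) \<and> finite {d. x d \<noteq> J d}"
  by (simp add: Ucomp_def)

lemma to_comp_zero: "to_comp m n c z 0 = J"
proof (intro ext)
  show "to_comp m n c z 0 e N = J e N" for e N
    using to_comp_eq[OF Fdeg_zero[of e], of e N] by (simp add: coset_zero)
qed

lemma homog_carrier:
  assumes "homog d y" "y d \<in> Ulim m n c z d"
  shows "y \<in> carrier (Ucomp m n c z)"
proof -
  have "{e. y e \<noteq> J e} \<subseteq> {d}"
    using assms(1) by (auto simp: homog_def)
  then have "finite {e. y e \<noteq> J e}"
    by (rule finite_subset) simp
  moreover have "y e \<in> Ulim m n c z e" for e
    using assms J_Ulim by (cases "e = d") (auto simp: homog_def)
  ultimately show ?thesis by (simp add: carrier_Ucomp)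
qed

lemma Ulim_coset: "f \<in> Fdeg d \<Longrightarrow> (\<lambda>N. coset d N f) \<in> Ulim m n c z d"
proof -
  assume f: "f \<in> Fdeg d"
  have "coset d N' f \<subseteq> coset d N f" if "N \<le> N'" for N N'
    using J_mono[OF that] by (auto simp: coset_eq[OF f] K_def)
  then show ?thesis using f by (auto simp: Ulim_def Uquot_eq)
qed

lemma to_comp_carrier: "f \<in> Fdeg d \<Longrightarrow> to_comp m n c z f \<in> carrier (Ucomp m n c z)"
proof (rule homog_carrier)
  assume f: "f \<in> Fdeg d"
  then show "homog d (to_comp m n c z f)" using rep_to_comp[OF f] by (simp add: rep_def)
  show "to_comp m n c z f d \<in> Ulim m n c z d"
    using Ulim_coset[OF f] by (simp add: to_comp_def part_homogeneous[OF f])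
qed

lemma coset_sum:
  assumes "f \<in> Fdeg d" "g \<in> Fdeg d"
  shows "coset d N f <+>\<^bsub>U\<^esub> coset d N g = coset d N (f + g)"
proof -
  interpret A: abelian_subgroup "J d N" U
    by (intro abelian_subgroupI3 additive_subgroup_J U.abelian_group_axioms)
  show ?thesis
    using assms by (simp add: A.a_rcos_sum cl_closed cl_add Fdeg_carrier)
qed

lemma Ucomp_add: "(x \<oplus>\<^bsub>Ucomp m n c z\<^esub> y) d N = x d N <+>\<^bsub>U\<^esub> y d N"
  by (simp add: Ucomp_def)

lemma rep_add:
  assumes "rep x d N f" "rep y d N g"
  shows "rep (x \<oplus>\<^bsub>Ucomp m n c z\<^esub> y) d N (f + g)"
proof -
  have "(x \<oplus>\<^bsub>Ucomp m n c z\<^esub> y) e = J e" if "e \<noteq> d" for e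
  proof
    show "(x \<oplus>\<^bsub>Ucomp m n c z\<^esub> y) e M = J e M" for M
      using assms that coset_sum[OF Fdeg_zero Fdeg_zero, of e M]
      by (simp add: Ucomp_add rep_def homog_def coset_zero)
  qed
  moreover have "(x \<oplus>\<^bsub>Ucomp m n c z\<^esub> y) d M \<in> Uquot m n c z d M" for M
  proof -
    obtain f' g' where "rep x d M f'" "rep y d M g'"
      using assms homog_obtain unfolding rep_def by metis
    then show ?thesis
      by (auto simp: Ucomp_add rep_def coset_sum Uquot_eq Fdeg_add)
  qed
  ultimately show ?thesis
    using assms by (simp add: rep_def homog_def Ucomp_add coset_sum Fdeg_add)
qed

text \<open>With \<open>x\<close> concentrated in degree \<open>d\<close>, at most one summand of
  the product remains, and it has to be shown that all choices of representatives agree modulo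
  \<open>J D N\<close>.\<close>

lemma Ucomp_mult:
  assumes x: "\<And>e. e \<noteq> d \<Longrightarrow> x e = J e"
    and f: "f \<in> Fdeg d" "x d (nat (int N - (D - d))) = coset d (nat (int N - (D - d))) f"
    and g: "g \<in> Fdeg (D - d)" "y (D - d) N = coset (D - d) N g"
  shows "(x \<otimes>\<^bsub>Ucomp m n c z\<^esub> y) D N = coset D N (f * g)"
proof -
  define M where "M = nat (int N - (D - d))"
  have M: "int N \<le> int M + (D - d)" by (simp add: M_def)
  have fg: "f * g \<in> Fdeg D" using Fdeg_mult[OF f(1) g(1)] by simp
  define S where "S = {e. x e \<noteq> J e}"
  have S: "S \<subseteq> {d}" using x by (auto simp: S_def)
  have eq: "(x \<otimes>\<^bsub>Ucomp m n c z\<^esub> y) D N =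
     (\<Union>a \<in> Pi S (\<lambda>e. x e (nat (int N - (D - e)))). \<Union>b \<in> Pi S (\<lambda>e. y (D - e) N).
          J D N +>\<^bsub>U\<^esub> (\<Oplus>\<^bsub>U\<^esub>e\<in>S. a e \<otimes>\<^bsub>U\<^esub> b e))"
    by (simp add: Ucomp_def Let_def S_def)
  show ?thesis
  proof (cases "d \<in> S")
    case True
    then have S: "S = {d}" using S by auto
    have cosets: "J D N +>\<^bsub>U\<^esub> (\<Oplus>\<^bsub>U\<^esub>e\<in>S. a e \<otimes>\<^bsub>U\<^esub> b e) = coset D N (f * g)"
      if "a d \<in> coset d M f" "b d \<in> coset (D - d) N g" for a b
    proof -
      obtain k k' where k: "k \<in> K d M" "a d = cl (k + f)" "k' \<in> K (D - d) N" "b d = cl (k' + g)"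
        using \<open>a d \<in> _\<close> \<open>b d \<in> _\<close> f(1) g(1) by (auto simp: coset_eq)
      note deg = K_Fdeg[OF k(1)] K_Fdeg[OF k(3)] f(1) g(1)
      have "(\<Oplus>\<^bsub>U\<^esub>e\<in>S. a e \<otimes>\<^bsub>U\<^esub> b e) = cl ((k + f) * (k' + g))"
        using deg k(2,4) Fdeg_carrier[OF Fdeg_add[OF deg(1,3)]] Fdeg_carrier[OF Fdeg_add[OF deg(2,4)]]
        by (simp add: S U.finsum_insert cl_closed cl_mult)
      \<comment> \<open>The error splits into a term with \<open>k\<close> on the left, controlled
        by the choice of \<open>M\<close>, and a term with \<open>k'\<close> on the right, whose
        level survives left multiplication.\<close>
      moreover have "(k + f) * (k' + g) - f * g = k * (k' + g) + f * k'"
        by (simp add: algebra_simps)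
      moreover have "k * (k' + g) \<in> K D N"
        using K_rmult[OF k(1) Fdeg_add[OF deg(2,4)] M] by simp
      moreover have "f * k' \<in> K D N"
        using K_lmult[OF k(3) f(1)] by simp
      moreover have "(k + f) * (k' + g) \<in> Fdeg D"
        using Fdeg_mult[OF Fdeg_add[OF deg(1,3)] Fdeg_add[OF deg(2,4)]] by simp
      ultimately show ?thesis
        using coset_eq_iff[of "(k + f) * (k' + g)" D "f * g" N] fg K_add by simp
    qed
    have "(\<lambda>_. cl f) \<in> Pi S (\<lambda>e. x e (nat (int N - (D - e))))"
      "(\<lambda>_. cl g) \<in> Pi S (\<lambda>e. y (D - e) N)"
      using f g coset_self by (auto simp: S)
    then have ne: "Pi S (\<lambda>e. x e (nat (int N - (D - e)))) \<noteq> {}" "Pi S (\<lambda>e. y (D - e) N) \<noteq> {}"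
      by blast+
    have "a d \<in> coset d M f" if "a \<in> Pi S (\<lambda>e. x e (nat (int N - (D - e))))" for a
      using that f(2) by (auto simp: S M_def)
    moreover have "b d \<in> coset (D - d) N g" if "b \<in> Pi S (\<lambda>e. y (D - e) N)" for b
      using that g(2) by (auto simp: S)
    ultimately have "J D N +>\<^bsub>U\<^esub> (\<Oplus>\<^bsub>U\<^esub>e\<in>S. a e \<otimes>\<^bsub>U\<^esub> b e) = coset D N (f * g)"
      if "a \<in> Pi S (\<lambda>e. x e (nat (int N - (D - e))))" "b \<in> Pi S (\<lambda>e. y (D - e) N)" for a b
      using cosets that by simp
    then show ?thesis
      unfolding eq by (rule UN2_constant[OF ne])
  next
    case False
    \<comment> \<open>Here \<open>x\<close> is zero in degree \<open>d\<close> as well, so the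
      product is an empty sum, while \<open>f\<close> lies in \<open>K d M\<close> and makes
      \<open>f * g\<close> negligible.\<close>
    then have "S = {}" using S by auto
    then have "(x \<otimes>\<^bsub>Ucomp m n c z\<^esub> y) D N = coset D N 0"
      by (simp add: eq cl_zero)
    moreover have "f \<in> K d M"
    proof -
      have "coset d M f = coset d M 0"
        using False f(2) by (simp add: S_def M_def coset_zero)
      then show ?thesis using coset_eq_iff[OF f(1) Fdeg_zero] by simp
    qed
    then have "f * g \<in> K D N"
      using K_rmult[OF _ g(1) M] by fastforce
    ultimately show ?thesis
      using coset_eq_iff[OF fg Fdeg_zero, of N] by simp
  qed
qed

text \<open>The left factor must be known at level \<open>N - e\<close>; \<open>nat\<close> cuts
  this off at 0, which is enough when \<open>e\<close> exceeds \<open>N\<close>.\<close>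

lemma rep_mult:
  assumes x: "rep x d (nat (int N - e)) f" and y: "rep y e N g"
  shows "rep (x \<otimes>\<^bsub>Ucomp m n c z\<^esub> y) (d + e) N (f * g)"
proof -
  have x0: "\<And>e. e \<noteq> d \<Longrightarrow> x e = J e" using x by (simp add: rep_def homog_def)
  \<comment> \<open>\<open>f\<close> is tied to one level of \<open>x\<close>, so at other degrees
    and levels a representative is chosen anew.\<close>
  have mult: "\<exists>f \<in> Fdeg d. (x \<otimes>\<^bsub>Ucomp m n c z\<^esub> y) D M = coset D M (f * g)"
    if "g \<in> Fdeg (D - d)" "y (D - d) M = coset (D - d) M g" for D M g
  proof -
    obtain f where "rep x d (nat (int M - (D - d))) f"
      using x homog_obtain unfolding rep_def by metis
    then show ?thesis
      using Ucomp_mult[OF x0] that by (auto simp: rep_def)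
  qed
  have "(x \<otimes>\<^bsub>Ucomp m n c z\<^esub> y) D M = J D M" if "D \<noteq> d + e" for D M
    using that y mult[OF Fdeg_zero, of D M] by (auto simp: rep_def homog_def coset_zero)
  moreover have "(x \<otimes>\<^bsub>Ucomp m n c z\<^esub> y) (d + e) M \<in> Uquot m n c z (d + e) M" for M
  proof -
    obtain g where "rep y e M g"
      using y homog_obtain unfolding rep_def by metis
    then show ?thesis
      using mult[of g "d + e" M] Fdeg_mult by (auto simp: rep_def Uquot_eq)
  qed
  moreover have "(x \<otimes>\<^bsub>Ucomp m n c z\<^esub> y) (d + e) N = coset (d + e) N (f * g)"
    using x y by (intro Ucomp_mult x0) (auto simp: rep_def)
  ultimately show ?thesis
    using x y by (auto simp: rep_def homog_def Fdeg_mult fun_eq_iff)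
qed

lemma rep_smult:
  assumes "rep x d N f"
  shows "rep (comp_smult m n c z a x) d N (scal a * f)"
  unfolding comp_smult_def using rep_mult[OF rep_to_comp[OF Fdeg_scal] assms] by simp

lemma rep_mono:
  "rep y d N f \<Longrightarrow> y \<in> carrier (Ucomp m n c z) \<Longrightarrow> M \<le> N \<Longrightarrow> rep y d M f"
  using Ulim_level_mono[of "y d" d f N M] by (simp add: rep_def carrier_Ucomp)

subsection \<open>Topology\<close>

lemma topspace_Ulim: "topspace (Ulim_topology m n c z d) = Ulim m n c z d"
proof -
  have "Ulim m n c z d \<subseteq> (\<Pi>\<^sub>E N \<in> UNIV. Uquot m n c z d N)"
    by (auto simp: Ulim_def)
  then show ?thesis
    by (auto simp: Ulim_topology_def)
qed

lemma openin_Ulim: "openin (Ulim_topology m n c z d) (Ulim m n c z d)"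
  using openin_topspace[of "Ulim_topology m n c z d"] by (simp add: topspace_Ulim)

lemma openin_Ulim_level:
  "openin (Ulim_topology m n c z d) {x \<in> Ulim m n c z d. x N = q}"
proof -
  have "continuous_map (Ulim_topology m n c z d) (discrete_topology (Uquot m n c z d N)) (\<lambda>x. x N)"
    unfolding Ulim_topology_def
    by (intro continuous_map_from_subtopology continuous_map_product_projection) simp
  then have "openin (Ulim_topology m n c z d)
      {x \<in> topspace (Ulim_topology m n c z d). x N \<in> {q} \<inter> Uquot m n c z d N}"
    by (rule openin_continuous_map_preimage) simp
  moreover have "x N \<in> Uquot m n c z d N" if "x \<in> Ulim m n c z d" for x
    using that by (simp add: Ulim_def)
  then have "{x \<in> topspace (Ulim_topology m n c z d). x N \<in> {q} \<inter> Uquot m n c z d N}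
      = {x \<in> Ulim m n c z d. x N = q}"
    by (auto simp: topspace_Ulim)
  ultimately show ?thesis by simp
qed

text \<open>A basic open set restricts finitely many coordinates, and the coordinate at level
  \<open>N\<close> determines all lower ones; so agreement at one large level suffices.\<close>

lemma openin_Ulim_nhd:
  assumes "openin (Ulim_topology m n c z d) W" "x \<in> W"
  shows "\<exists>N. \<forall>y \<in> Ulim m n c z d. y N = x N \<longrightarrow> y \<in> W"
proof -
  let ?P = "product_topology (\<lambda>N. discrete_topology (Uquot m n c z d N)) UNIV"
  obtain T where T: "openin ?P T" "W = T \<inter> Ulim m n c z d"
    using assms(1) by (auto simp: Ulim_topology_def openin_subtopology)
  then obtain V where V: "finite {i. V i \<noteq> Uquot m n c z d i}" "x \<in> Pi\<^sub>E UNIV V" "Pi\<^sub>E UNIV V \<subseteq> T"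
    using assms(2) by (auto simp: openin_product_topology_alt)
  then obtain N where "\<forall>i \<in> {i. V i \<noteq> Uquot m n c z d i}. i \<le> N"
    unfolding finite_nat_set_iff_bounded_le by blast
  then have N: "i \<le> N" if "V i \<noteq> Uquot m n c z d i" for i
    using that by simp
  have "y \<in> W" if y: "y \<in> Ulim m n c z d" "y N = x N" for y
  proof -
    have "y i \<in> V i" for i
    proof (cases "i \<le> N")
      case True
      then have "y i = x i"
        using Ulim_level_eq[of x d y N i] y T(2) assms(2) by auto
      then show ?thesis using V(2) by (auto simp: PiE_iff)
    next
      case False
      then have "V i = Uquot m n c z d i" using N by blast
      then show ?thesis using y(1) by (simp add: Ulim_def)
    qed
    then show ?thesis using V(3) y(1) T(2) by (auto simp: PiE_iff)
  qed
  then show ?thesis by blast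
qed

definition deg_box :: "(int \<Rightarrow> (nat \<Rightarrow> ggen falg set set) set) \<Rightarrow> ucomp set" where
  "deg_box W = {x \<in> carrier (Ucomp m n c z). \<forall>d. x d \<in> W d}"

lemma openin_box:
  "(\<And>d. openin (Ulim_topology m n c z d) (W d)) \<Longrightarrow> openin (Ucomp_topology m n c z) (deg_box W)"
  unfolding Ucomp_topology_def deg_box_def by (rule topology_generated_by_Basis) blast

text \<open>Boxes are closed under binary intersection, so the generating family is a basis.\<close>

lemma openin_Ucomp_nhd:
  assumes "openin (Ucomp_topology m n c z) T" "x \<in> T"
  shows "\<exists>W. (\<forall>d. openin (Ulim_topology m n c z d) (W d)) \<and> x \<in> deg_box W \<and> deg_box W \<subseteq> T"
  using openin_topology_generated_by[OF assms(1)[unfolded Ucomp_topology_def]] assms(2)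
proof (induction)
  case (Int S T)
  obtain V where V: "\<forall>d. openin (Ulim_topology m n c z d) (V d)" "x \<in> deg_box V" "deg_box V \<subseteq> S"
    using Int by blast
  obtain W where W: "\<forall>d. openin (Ulim_topology m n c z d) (W d)" "x \<in> deg_box W" "deg_box W \<subseteq> T"
    using Int by blast
  have "deg_box (\<lambda>d. V d \<inter> W d) = deg_box V \<inter> deg_box W" by (auto simp: deg_box_def)
  then show ?case
    using V W by (intro exI[of _ "\<lambda>d. V d \<inter> W d"]) (auto simp: openin_Int)
next
  case (UN K)
  then obtain k where k: "k \<in> K" "x \<in> k" by blast
  obtain W where "\<forall>d. openin (Ulim_topology m n c z d) (W d)" "x \<in> deg_box W" "deg_box W \<subseteq> k"
    using UN.IH[OF k] by blast
  then show ?case using k(1) by (intro exI[of _ W]) auto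
next
  case (Basis S)
  then obtain W where "\<forall>d. openin (Ulim_topology m n c z d) (W d)" "S = deg_box W"
    by (auto simp: deg_box_def)
  then show ?case using Basis by (intro exI[of _ W]) simp
qed simp

lemma topspace_Ucomp: "topspace (Ucomp_topology m n c z) = carrier (Ucomp m n c z)"
proof
  have "carrier (Ucomp m n c z) = deg_box (\<lambda>d. Ulim m n c z d)"
    by (auto simp: carrier_Ucomp deg_box_def)
  then show "carrier (Ucomp m n c z) \<subseteq> topspace (Ucomp_topology m n c z)"
    using openin_subset[OF openin_box[of "\<lambda>d. Ulim m n c z d"]] openin_Ulim by simp
qed (auto simp: Ucomp_topology_def)

text \<open>Fixing the value at one degree and one level is an open condition. This yields
  uniqueness of limits of series.\<close>

lemma limitin_level:
  assumes "limitin (Ucomp_topology m n c z) Y l sequentially"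
  shows "eventually (\<lambda>k. Y k d N = l d N) sequentially"
proof -
  let ?W = "\<lambda>e. if e = d then {x \<in> Ulim m n c z d. x N = l d N} else Ulim m n c z e"
  have l: "l \<in> carrier (Ucomp m n c z)"
    using limitin_topspace[OF assms] by (simp add: topspace_Ucomp)
  have "openin (Ucomp_topology m n c z) (deg_box ?W)"
    by (rule openin_box) (simp add: openin_Ulim_level openin_Ulim)
  moreover have "l \<in> deg_box ?W"
    using l by (auto simp: carrier_Ucomp deg_box_def)
  ultimately have "eventually (\<lambda>k. Y k \<in> deg_box ?W) sequentially"
    using assms unfolding limitin_def by blast
  then show ?thesis
    by (rule eventually_mono) (auto simp: deg_box_def dest!: spec[of _ d])
qed

text \<open>\<open>comp_series\<close> is a definite description, so a limit has to be exhibited and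
  shown to be unique.\<close>

lemma rep_comp_series:
  assumes f: "\<And>s. f s \<in> Fdeg d" and K: "\<And>s N. s > N \<Longrightarrow> f s \<in> K d N"
  shows "rep (comp_series m n c z f) d N (\<Sum>s\<le>N. f s)"
proof -
  \<comment> \<open>At level \<open>N\<close> the terms after \<open>s = N\<close> lie in
    \<open>K d N\<close> and do not count.\<close>
  define l where "l = (\<lambda>e N. if e = d then coset d N (\<Sum>s\<le>N. f s) else J e N)"
  let ?X = "\<lambda>k. to_comp m n c z (\<Sum>s<k. f s)"
  have F: "(\<Sum>s\<in>A. f s) \<in> Fdeg d" for A
    by (rule Fdeg_sum) (rule f)
  have stable: "coset d N (\<Sum>s<k. f s) = coset d N (\<Sum>s\<le>N. f s)" if "N < k" for N k
  proof -
    have "{..<k} = {..N} \<union> {N<..<k}" using that by auto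
    then have "(\<Sum>s<k. f s) - (\<Sum>s\<le>N. f s) = (\<Sum>s\<in>{N<..<k}. f s)"
      by (simp add: sum.union_disjoint ivl_disj_int)
    also have "\<dots> \<in> K d N" by (rule K_sum) (auto intro: K)
    finally show ?thesis using coset_eq_iff[OF F F] by blast
  qed
  have rl: "rep l d N (\<Sum>s\<le>N. f s)" for N
    using F by (auto simp: rep_def homog_def l_def Uquot_eq)
  have "l d \<in> Ulim m n c z d"
  proof -
    have "coset d N' (\<Sum>s\<le>N'. f s) \<subseteq> coset d N (\<Sum>s\<le>N. f s)" if "N \<le> N'" for N N'
    proof -
      have "coset d N' (\<Sum>s\<le>N'. f s) \<subseteq> coset d N (\<Sum>s\<le>N'. f s)"
        using J_mono[OF that] by (auto simp: coset_eq[OF F] K_def)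
      then show ?thesis using stable[of N "Suc N'"] that by (simp add: lessThan_Suc_atMost)
    qed
    then show ?thesis using F by (auto simp: l_def Ulim_def Uquot_eq)
  qed
  then have l: "l \<in> carrier (Ucomp m n c z)"
    using rl homog_carrier by (auto simp: rep_def)
  have "limitin (Ucomp_topology m n c z) ?X l sequentially"
    unfolding limitin_def
  proof (intro conjI allI impI)
    fix T assume T: "openin (Ucomp_topology m n c z) T \<and> l \<in> T"
    obtain W where W: "\<And>d. openin (Ulim_topology m n c z d) (W d)" "l \<in> deg_box W" "deg_box W \<subseteq> T"
      using openin_Ucomp_nhd[of T l] T by blast
    obtain N where N: "\<And>y. y \<in> Ulim m n c z d \<Longrightarrow> y N = l d N \<Longrightarrow> y \<in> W d"
      using openin_Ulim_nhd[OF W(1), of "l d" d] W(2) by (auto simp: deg_box_def)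
    have "?X k \<in> deg_box W" if "N < k" for k
    proof -
      have X: "?X k \<in> carrier (Ucomp m n c z)" by (rule to_comp_carrier[OF F])
      have "?X k e \<in> W e" for e
      proof (cases "e = d")
        case True
        then show ?thesis
          using N[of "?X k d"] X stable[OF that]
          by (simp add: carrier_Ucomp to_comp_eq[OF F] l_def)
      next
        case False
        then have "?X k e = l e"
          by (simp add: fun_eq_iff to_comp_eq[OF F] l_def)
        then show ?thesis using W(2) by (simp add: deg_box_def)
      qed
      then show ?thesis using X by (simp add: deg_box_def)
    qed
    then show "eventually (\<lambda>k. ?X k \<in> T) sequentially"
      using W(3) by (intro eventually_sequentiallyI[of "Suc N"]) (auto simp: Suc_le_eq)
  qed (simp add: topspace_Ucomp l)
  \<comment> \<open>At each degree and level both limits agree with a common late partial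
    sum.\<close>
  moreover have "l' = l" if "limitin (Ucomp_topology m n c z) ?X l' sequentially" for l'
  proof (intro ext)
    fix e N
    have "eventually (\<lambda>k. ?X k e N = l' e N \<and> ?X k e N = l e N) sequentially"
      by (intro eventually_conj limitin_level that calculation)
    then show "l' e N = l e N"
      by (auto dest: eventually_happens)
  qed
  ultimately have "comp_series m n c z f = l"
    unfolding comp_series_def by (rule the_equality)
  then show ?thesis using rl by simp
qed

text \<open>A neighbourhood of \<open>x\<close> contains a box, and in each degree agreement with
  \<open>x\<close> at one level \<open>N d\<close> secures the box. As \<open>x\<close> has finitely
  many nonzero components, a finite sum of homogeneous elements of \<open>A\<close>
  suffices.\<close>

lemma dense_if_levelwise:
  assumes sub: "A \<subseteq> carrier (Ucomp m n c z)"
    and zero: "J \<in> A"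
    and add: "\<And>x y. x \<in> A \<Longrightarrow> y \<in> A \<Longrightarrow> x \<oplus>\<^bsub>Ucomp m n c z\<^esub> y \<in> A"
    and rep: "\<And>d N f. f \<in> Fdeg d \<Longrightarrow> \<exists>y \<in> A. rep y d N f"
  shows "Ucomp_topology m n c z closure_of A = carrier (Ucomp m n c z)"
proof
  show "Ucomp_topology m n c z closure_of A \<subseteq> carrier (Ucomp m n c z)"
    using closure_of_subset_topspace topspace_Ucomp by metis
next
  show "carrier (Ucomp m n c z) \<subseteq> Ucomp_topology m n c z closure_of A"
  proof
    fix x assume x: "x \<in> carrier (Ucomp m n c z)"
    have "\<exists>y \<in> A. y \<in> T" if T: "x \<in> T" "openin (Ucomp_topology m n c z) T" for T
    proof -
      obtain W where W: "\<And>d. openin (Ulim_topology m n c z d) (W d)" "x \<in> deg_box W" "deg_box W \<subseteq> T"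
        using openin_Ucomp_nhd[OF T(2,1)] by blast
      then have "\<exists>N. \<forall>y \<in> Ulim m n c z d. y N = x d N \<longrightarrow> y \<in> W d" for d
        using openin_Ulim_nhd[OF W(1), of "x d" d for d] by (auto simp: deg_box_def)
      then obtain N where N: "\<And>d y. y \<in> Ulim m n c z d \<Longrightarrow> y (N d) = x d (N d) \<Longrightarrow> y \<in> W d"
        by metis
      \<comment> \<open>Approximations are added one degree at a time; each is zero in all other
        degrees.\<close>
      have approx: "\<exists>y \<in> A. \<forall>d. y d (N d) = (if d \<in> S then x d (N d) else J d (N d))"
        if "finite S" for S
        using that
      proof induction
        case empty
        then show ?case using zero by auto
      next
        case (insert e S)
        then obtain y where y: "y \<in> A" "\<And>d. y d (N d) = (if d \<in> S then x d (N d) else J d (N d))"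
          by blast
        obtain f where f: "f \<in> Fdeg e" "x e (N e) = coset e (N e) f"
          using x Ulim_obtain[of "x e" e "N e"] by (auto simp: carrier_Ucomp)
        then obtain y' where y': "y' \<in> A" "rep y' e (N e) f"
          using rep by blast
        have "(y \<oplus>\<^bsub>Ucomp m n c z\<^esub> y') d (N d) =
            (if d \<in> insert e S then x d (N d) else J d (N d))" for d
        proof (cases "d = e")
          case True
          then show ?thesis
            using y(2)[of e] y'(2) insert.hyps f coset_sum[OF Fdeg_zero f(1), of "N e"]
            by (simp add: Ucomp_add rep_def coset_zero)
        next
          case False
          obtain g where g: "g \<in> Fdeg d" "y d (N d) = coset d (N d) g"
            using subsetD[OF sub y(1)] Ulim_obtain[of "y d" d "N d"] by (auto simp: carrier_Ucomp)
          then have "(y \<oplus>\<^bsub>Ucomp m n c z\<^esub> y') d (N d) = y d (N d)"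
            using False y'(2) coset_sum[OF g(1) Fdeg_zero, of "N d"]
            by (simp add: Ucomp_add rep_def homog_def coset_zero)
          then show ?thesis using y(2) False by simp
        qed
        then show ?case using add[OF y(1) y'(1)] by blast
      qed
      obtain y where y: "y \<in> A"
        "\<And>d. y d (N d) = (if x d \<noteq> J d then x d (N d) else J d (N d))"
        using approx[of "{d. x d \<noteq> J d}"] x by (auto simp: carrier_Ucomp)
      have "y d \<in> W d" for d
        using subsetD[OF sub y(1)] y(2)[of d] by (intro N) (auto simp: carrier_Ucomp)
      then have "y \<in> T" using W(3) subsetD[OF sub y(1)] by (auto simp: deg_box_def)
      then show ?thesis using y(1) by blast
    qed
    then show "x \<in> Ucomp_topology m n c z closure_of A"
      using x by (auto simp: in_closure_of topspace_Ucomp)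
  qed
qed

subsection \<open>Commutation relations\<close>

abbreviation idx where "idx \<equiv> {1..m + n}"

lemma gE_Fdeg: "i \<in> idx \<Longrightarrow> j \<in> idx \<Longrightarrow> gE i j u \<in> Fdeg u"
  using Fdeg_gen[of "GE i j u"] by (simp add: ggens_def)

text \<open>Equality in \<open>U\<close>, bundled with membership in the carrier so that the
  congruence rules need no side conditions.\<close>

definition eqv :: "ggen falg \<Rightarrow> ggen falg \<Rightarrow> bool" where
  "eqv f g \<longleftrightarrow> f \<in> carrier F \<and> g \<in> carrier F \<and> cl f = cl g"

lemma eqv_refl: "f \<in> carrier F \<Longrightarrow> eqv f f"
  by (simp add: eqv_def)

lemma eqv_trans [trans]: "eqv f g \<Longrightarrow> eqv g h \<Longrightarrow> eqv f h"
  by (simp add: eqv_def)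

lemma eqv_sym: "eqv f g \<Longrightarrow> eqv g f"
  by (simp add: eqv_def)

lemma eqv_add: "eqv f g \<Longrightarrow> eqv f' g' \<Longrightarrow> eqv (f + f') (g + g')"
  by (simp add: eqv_def free_algebra_closed cl_add)

lemma eqv_diff: "eqv f g \<Longrightarrow> eqv f' g' \<Longrightarrow> eqv (f - f') (g - g')"
  by (simp add: eqv_def free_algebra_closed cl_diff)

lemma eqv_mult: "eqv f g \<Longrightarrow> eqv f' g' \<Longrightarrow> eqv (f * f') (g * g')"
  by (simp add: eqv_def free_algebra_closed cl_mult)

lemma eqv_sum: "(\<And>x. x \<in> A \<Longrightarrow> eqv (f x) (g x)) \<Longrightarrow> eqv (sum f A) (sum g A)"
  by (induction A rule: infinite_finite_induct) (auto intro: eqv_add eqv_refl zero_one_closed)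

lemma eqv_urels: "f - g \<in> urels m n c z \<Longrightarrow> f \<in> carrier F \<Longrightarrow> g \<in> carrier F \<Longrightarrow> eqv f g"
  using cl_eq_0[of "f - g"] by (simp add: eqv_def cl_diff cl_closed)

lemma GC_GZ_closed: "gen GC \<in> carrier F" "gen GZ \<in> carrier F"
  by (auto intro!: gen_closed simp: ggens_def)

lemma eqv_GC: "eqv (gen GC) (scal c)" and eqv_GZ: "eqv (gen GZ) (scal z)"
  by (auto intro!: eqv_urels GC_GZ_closed scal_closed simp: urels_def)

lemma bracket_value_Fdeg:
  assumes "i \<in> idx" "j \<in> idx" "k \<in> idx" "l \<in> idx"
  shows "bracket_value m c z i j u k l v \<in> Fdeg (u + v)"
  unfolding bracket_value_def
  by (intro Fdeg_add Fdeg_diff Fdeg_scal_mult)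
     (auto intro!: gE_Fdeg Fdeg_zero assms simp: Fdeg_scal)

text \<open>The defining relation for two matrix units, followed by the specialisation of
  \<open>GC\<close> and \<open>GZ\<close>.\<close>

lemma eqv_bracket:
  assumes idx: "i \<in> idx" "j \<in> idx" "k \<in> idx" "l \<in> idx"
  shows "eqv (gE i j u * gE k l v
      - scal ((-1) ^ ((pr m i + pr m j) * (pr m k + pr m l))) * (gE k l v * gE i j u))
    (bracket_value m c z i j u k l v)"
proof -
  let ?s = "(-1) ^ ((pr m i + pr m j) * (pr m k + pr m l)) :: complex"
  let ?p = "gE i j u * gE k l v - scal ?s * (gE k l v * gE i j u)"
  let ?C = "of_int u * (if j = k \<and> i = l then (-1) ^ pr m i else 0) :: complex"
  let ?Z = "of_int u * (if i = j \<and> k = l then (-1) ^ pr m i * (-1) ^ pr m k else 0) :: complex"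
  let ?L = "(if j = k then gE i l (u + v) else 0) - scal ?s * (if l = i then gE k j (u + v) else 0)"
  have gens: "GE i j u \<in> ggens m n" "GE k l v \<in> ggens m n"
    using idx by (auto simp: ggens_def)
  have p: "sbracket (godd m) (gE i j u) (gE k l v) = ?p"
    by (auto simp: sbracket_gen)
  have cls: "?p \<in> carrier F" "?L \<in> carrier F"
    using idx by (auto intro!: free_algebra_closed scal_closed zero_one_closed gen_closed simp: ggens_def)
  have lin: "lin (aff_bracket m n (GE i j u) (GE k l v)) =
      ?L + (if u + v = 0 then scal ?C * gen GC + scal ?Z * gen GZ else 0)"
    using idx by (simp add: lin_add lin_loop_bracket lin_single lin_zero str_mmul_munit str_munit)
  have "eqv ?p (?L + (if u + v = 0 then scal ?C * gen GC + scal ?Z * gen GZ else 0))"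
  proof (rule eqv_urels)
    show "?p - (?L + (if u + v = 0 then scal ?C * gen GC + scal ?Z * gen GZ else 0)) \<in> urels m n c z"
      unfolding urels_def lin[symmetric] p[symmetric] using gens by blast
    show "?L + (if u + v = 0 then scal ?C * gen GC + scal ?Z * gen GZ else 0) \<in> carrier F"
      by (rule free_algebra_closed(1)[OF cls(2)])
         (simp add: free_algebra_closed scal_closed zero_one_closed GC_GZ_closed)
  qed (rule cls)
  also have "eqv \<dots> (?L + (if u + v = 0 then scal ?C * scal c + scal ?Z * scal z else 0))"
    by (rule eqv_add[OF eqv_refl[OF cls(2)]])
       (simp add: eqv_add eqv_mult eqv_refl eqv_GC eqv_GZ scal_closed zero_one_closed)
  also have "?L + (if u + v = 0 then scal ?C * scal c + scal ?Z * scal z else 0)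
      = bracket_value m c z i j u k l v"
    by (simp add: bracket_value_def scal_add scal_mult)
  finally show ?thesis .
qed

text \<open>Indices 1 and 2 are both even, so the \<open>z\<close> terms of \<open>E_11(u)\<close>
  and \<open>E_22(u)\<close> cancel in the difference and only a multiple of \<open>c\<close> is
  left.\<close>

lemma eqv_cartan:
  assumes ab: "a \<in> {1, 2}" and "m \<ge> 2"
  shows "eqv (gE a a s * (gE 1 1 u - gE 2 2 u) - (gE 1 1 u - gE 2 2 u) * gE a a s)
     (scal (if s + u = 0 then (if a = 1 then 1 else -1) * of_int s * c else 0))"
proof -
  have [simp]: "pr m 1 = 0" "pr m (Suc 0) = 0" "pr m 2 = 0" "pr m a = 0" using assms by (auto simp: pr_def)
  have idx: "a \<in> idx" "1 \<in> idx" "2 \<in> idx" using assms by auto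
  have "eqv (gE a a s * gE b b u - gE b b u * gE a a s) (bracket_value m c z a a s b b u)"
    if "b \<in> {1, 2}" for b
    using eqv_bracket[OF idx(1,1), of b b s u] that idx by (auto simp: scal_one)
  from eqv_diff[OF this[of 1] this[of 2]]
  have "eqv (gE a a s * (gE 1 1 u - gE 2 2 u) - (gE 1 1 u - gE 2 2 u) * gE a a s)
     (bracket_value m c z a a s 1 1 u - bracket_value m c z a a s 2 2 u)"
    by (simp add: algebra_simps)
  moreover have "bracket_value m c z a a s 1 1 u - bracket_value m c z a a s 2 2 u
      = scal (if s + u = 0 then (if a = 1 then 1 else -1) * of_int s * c else 0)"
    using ab by (auto simp: bracket_value_def scal_one scal_zero scal_add scal_uminus)
  ultimately show ?thesis by simp
qed

text \<open>Leibniz rule for the commutator with \<open>h\<close>.\<close>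

lemma eqv_comm_mult:
  assumes "eqv (f * h - h * f) f'" "eqv (g * h - h * g) g'" "f \<in> carrier F" "g \<in> carrier F"
  shows "eqv (f * g * h - h * (f * g)) (f * g' + f' * g)"
proof -
  have "f * g * h - h * (f * g) = f * (g * h - h * g) + (f * h - h * f) * g"
    by (simp add: algebra_simps)
  then show ?thesis using assms by (simp add: eqv_add eqv_mult eqv_refl)
qed

text \<open>Truncation of the infinite series: the omitted summands lie in \<open>K 0 N\<close>, so
  nothing is lost at level \<open>N\<close>.\<close>

definition V :: "nat \<Rightarrow> ggen falg" where
  "V N = (\<Sum>s\<le>N. gE 1 1 (- int s) * gE 1 1 (int s))
       - (\<Sum>s\<le>N. gE 2 2 (- int s - 1) * gE 2 2 (int s + 1)) - gE 1 1 0 * gE 2 2 0"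

text \<open>Each commutator of a factor with \<open>E_11(u) - E_22(u)\<close> is a scalar, nonzero
  only if the degrees cancel; so one term of each sum contributes. The bound on \<open>u\<close>
  keeps both terms inside the truncation.\<close>

lemma eqv_comm_V:
  assumes "m \<ge> 2" "u \<noteq> 0" "\<bar>u\<bar> \<le> int N"
  shows "eqv (V N * (gE 1 1 u - gE 2 2 u) - (gE 1 1 u - gE 2 2 u) * V N)
    (scal (- of_int u * c) * (gE 1 1 u + gE 2 2 u))"
proof -
  let ?H = "gE 1 1 u - gE 2 2 u"
  let ?k = "\<lambda>s. if s + u = 0 then of_int s * c else (0 :: complex)"
  have cls: "gE 1 1 s \<in> carrier F" "gE 2 2 s \<in> carrier F" for s
    using gE_Fdeg[of 1 1 s] gE_Fdeg[of 2 2 s] assms(1) by (auto intro: Fdeg_carrier)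
  have e: "eqv (gE 1 1 s * ?H - ?H * gE 1 1 s) (scal (?k s))" for s
    using eqv_cartan[of 1 s u] assms(1) by (auto cong: if_cong)
  have f: "eqv (gE 2 2 s * ?H - ?H * gE 2 2 s) (scal (- ?k s))" for s
    using eqv_cartan[of 2 s u] assms(1) by (auto cong: if_cong)
  \<comment> \<open>At \<open>s = \<bar>u\<bar>\<close> the left or the right factor contributes,
    according to the sign of \<open>u\<close>; both cases give the same value.\<close>
  have "(\<Sum>s\<le>N. gE 1 1 (- int s) * scal (?k (int s)) + scal (?k (- int s)) * gE 1 1 (int s))
      = (\<Sum>s\<le>N. if s = nat \<bar>u\<bar> then scal (- of_int u * c) * gE 1 1 u else 0)"
    using assms(2) by (intro sum.cong refl) (auto simp: scal_comm scal_zero)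
  also have "\<dots> = scal (- of_int u * c) * gE 1 1 u"
    using assms(3) by (auto simp: nat_le_iff)
  finally have E: "(\<Sum>s\<le>N. gE 1 1 (- int s) * scal (?k (int s)) + scal (?k (- int s)) * gE 1 1 (int s))
      = scal (- of_int u * c) * gE 1 1 u" .
  \<comment> \<open>The shift by one in the second series moves the contributing index to
    \<open>\<bar>u\<bar> - 1\<close>, which is nonnegative because
    \<open>u \<noteq> 0\<close>.\<close>
  have "(\<Sum>s\<le>N. gE 2 2 (- int s - 1) * scal (- ?k (int s + 1)) + scal (- ?k (- int s - 1)) * gE 2 2 (int s + 1))
      = (\<Sum>s\<le>N. if s = nat (\<bar>u\<bar> - 1) then - scal (- of_int u * c) * gE 2 2 u else 0)"
  proof (intro sum.cong refl)
    fix s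
    consider "u = int s + 1" | "u = - int s - 1" | "u \<noteq> int s + 1" "u \<noteq> - int s - 1" by blast
    then show "gE 2 2 (- int s - 1) * scal (- ?k (int s + 1)) + scal (- ?k (- int s - 1)) * gE 2 2 (int s + 1)
        = (if s = nat (\<bar>u\<bar> - 1) then - scal (- of_int u * c) * gE 2 2 u else 0)"
    proof cases
      case 3
      moreover have "s \<noteq> nat (\<bar>u\<bar> - 1)" using 3 assms(2) by auto
      ultimately show ?thesis by (auto simp: scal_zero)
    next
      case 1
      then have s: "int s + 1 = u" "- int s - 1 = - u" "s = nat (\<bar>u\<bar> - 1)" by auto
      show ?thesis
        unfolding s(1,2) using s(3) assms(2) by (simp add: scal_zero scal_uminus)
    next
      case 2
      then have s: "- int s - 1 = u" "int s + 1 = - u" "s = nat (\<bar>u\<bar> - 1)" by auto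
      show ?thesis
        unfolding s(1,2) using s(3) assms(2) by (simp add: scal_zero scal_uminus scal_comm)
    qed
  qed
  also have "\<dots> = - scal (- of_int u * c) * gE 2 2 u"
    using assms(3) by (auto simp: nat_le_iff)
  finally have F: "(\<Sum>s\<le>N. gE 2 2 (- int s - 1) * scal (- ?k (int s + 1)) + scal (- ?k (- int s - 1)) * gE 2 2 (int s + 1))
      = - scal (- of_int u * c) * gE 2 2 u" .
  have V: "V N * ?H - ?H * V N =
      (\<Sum>s\<le>N. gE 1 1 (- int s) * gE 1 1 (int s) * ?H - ?H * (gE 1 1 (- int s) * gE 1 1 (int s)))
    - (\<Sum>s\<le>N. gE 2 2 (- int s - 1) * gE 2 2 (int s + 1) * ?H - ?H * (gE 2 2 (- int s - 1) * gE 2 2 (int s + 1)))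
    - (gE 1 1 0 * gE 2 2 0 * ?H - ?H * (gE 1 1 0 * gE 2 2 0))"
    \<comment> \<open>Distributivity is instantiated so that \<open>?H\<close>, itself a difference,
      is not expanded.\<close>
    by (simp only: V_def left_diff_distrib[of _ _ ?H] right_diff_distrib[of ?H] sum_distrib_left
        sum_distrib_right sum_subtractf) (simp only: diff_diff_eq2 diff_conv_add_uminus minus_add minus_minus add_ac)
  have "eqv (V N * ?H - ?H * V N)
      ((\<Sum>s\<le>N. gE 1 1 (- int s) * scal (?k (int s)) + scal (?k (- int s)) * gE 1 1 (int s))
     - (\<Sum>s\<le>N. gE 2 2 (- int s - 1) * scal (- ?k (int s + 1)) + scal (- ?k (- int s - 1)) * gE 2 2 (int s + 1))
     - (gE 1 1 0 * scal (- ?k 0) + scal (?k 0) * gE 2 2 0))"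
    unfolding V by (intro eqv_diff eqv_sum eqv_comm_mult e f cls)
  \<comment> \<open>The value in \<open>F\<close> has the opposite sign, which the minus in
    \<open>V\<close> reverses: hence the sum of \<open>E_11(u)\<close> and \<open>E_22(u)\<close>.
    The product of degree-zero units contributes nothing since \<open>u \<noteq> 0\<close>.\<close>
  then show ?thesis
    unfolding E F using assms(2) by (simp add: scal_zero distrib_left)
qed

text \<open>The brackets that isolate \<open>E_11(0)\<close>. In the last one the degrees 1 and -1
  cancel, which produces \<open>c\<close>.\<close>

lemma eqv_matrix_units:
  assumes "m \<ge> 2"
  shows "eqv (gE 1 1 0 * gE 1 2 1 - gE 1 2 1 * gE 1 1 0) (gE 1 2 1)"
    and "eqv (gE 2 2 0 * gE 1 2 1 - gE 1 2 1 * gE 2 2 0) (- gE 1 2 1)"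
    and "eqv (gE 1 1 0 * gE 2 1 (-1) - gE 2 1 (-1) * gE 1 1 0) (- gE 2 1 (-1))"
    and "eqv (gE 1 2 1 * gE 2 1 (-1) - gE 2 1 (-1) * gE 1 2 1) (gE 1 1 0 - gE 2 2 0 + scal c)"
proof -
  have [simp]: "pr m 1 = 0" "pr m (Suc 0) = 0" "pr m 2 = 0" using assms by (auto simp: pr_def)
  have idx: "1 \<in> idx" "2 \<in> idx" using assms by auto
  show "eqv (gE 1 1 0 * gE 1 2 1 - gE 1 2 1 * gE 1 1 0) (gE 1 2 1)"
    using eqv_bracket[OF idx(1,1,1,2), of 0 1] by (simp add: scal_one scal_zero bracket_value_def)
  show "eqv (gE 2 2 0 * gE 1 2 1 - gE 1 2 1 * gE 2 2 0) (- gE 1 2 1)"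
    using eqv_bracket[OF idx(2,2,1,2), of 0 1] by (simp add: scal_one scal_zero bracket_value_def)
  show "eqv (gE 1 1 0 * gE 2 1 (-1) - gE 2 1 (-1) * gE 1 1 0) (- gE 2 1 (-1))"
    using eqv_bracket[OF idx(1,1,2,1), of 0 "-1"] by (simp add: scal_one scal_zero bracket_value_def)
  show "eqv (gE 1 2 1 * gE 2 1 (-1) - gE 2 1 (-1) * gE 1 2 1) (gE 1 1 0 - gE 2 2 0 + scal c)"
    using eqv_bracket[OF idx(1,2,2,1), of 1 "-1"] by (simp add: scal_one scal_zero bracket_value_def)
qed

text \<open>The right factors have degree \<open>r\<close>, so a summand with \<open>r > N\<close>
  is negligible at level \<open>N\<close>. These are the hypotheses of
  \<open>rep_comp_series\<close> for the evaluation series.\<close>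

lemma series_term:
  assumes "S \<subseteq> idx" "i \<in> idx" "j \<in> idx" "q = - r"
  shows "(\<Sum>k\<in>S. scal (t k) * gE i k q * gE k j r) \<in> Fdeg 0"
    and "int N < r \<Longrightarrow> (\<Sum>k\<in>S. scal (t k) * gE i k q * gE k j r) \<in> K 0 N"
proof -
  have deg: "scal (t k) * gE i k q \<in> Fdeg (0 - r)" "gE k j r \<in> Fdeg r" if "k \<in> S" for k
    using that assms by (auto intro!: Fdeg_scal_mult gE_Fdeg)
  show "(\<Sum>k\<in>S. scal (t k) * gE i k q * gE k j r) \<in> Fdeg 0"
    using Fdeg_mult[OF deg] by (intro Fdeg_sum) simp
  show "(\<Sum>k\<in>S. scal (t k) * gE i k q * gE k j r) \<in> K 0 N" if "int N < r"
    using K_prod[OF deg that] by (intro K_sum)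
qed

lemma ev_h_Fdeg: "1 \<le> i \<Longrightarrow> i < m + n \<Longrightarrow> ev_h m n c i \<in> Fdeg 0"
  by (auto simp: ev_h_def intro!: Fdeg_diff Fdeg_scal_mult gE_Fdeg)

text \<open>At level \<open>N\<close> all four series may be cut off after
  \<open>s = N\<close>.\<close>

lemma rep_ev_hi1:
  assumes i: "1 \<le> i" "i < m + n"
  shows "rep (ev_hi1 m n \<epsilon>1 \<epsilon>2 \<alpha> c z i) 0 N
    (scal (\<alpha> - (of_nat i - 2 * (if i \<ge> m + 1 then 1 else 0) * (of_nat i - of_nat m)) * \<epsilon>1) * ev_h m n c i
     - scal ((-1) ^ (pr m i + pr m (i + 1)) * (\<epsilon>1 + \<epsilon>2)) * gE i i 0 * gE (i + 1) (i + 1) 0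
     + scal ((\<epsilon>1 + \<epsilon>2) * (-1) ^ pr m i) * (\<Sum>s\<le>N. \<Sum>k = 1..i.
             scal ((-1) ^ pr m k) * gE i k (- int s) * gE k i (int s))
     + scal ((\<epsilon>1 + \<epsilon>2) * (-1) ^ pr m i) * (\<Sum>s\<le>N. \<Sum>k = i + 1..m + n.
             scal ((-1) ^ pr m k) * gE i k (- int s - 1) * gE k i (int s + 1))
     + scal (- (\<epsilon>1 + \<epsilon>2) * (-1) ^ pr m (i + 1)) * (\<Sum>s\<le>N. \<Sum>k = 1..i.
             scal ((-1) ^ pr m k) * gE (i + 1) k (- int s) * gE k (i + 1) (int s))
     + scal (- (\<epsilon>1 + \<epsilon>2) * (-1) ^ pr m (i + 1)) * (\<Sum>s\<le>N. \<Sum>k = i + 1..m + n.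
             scal ((-1) ^ pr m k) * gE (i + 1) k (- int s - 1) * gE k (i + 1) (int s + 1)))"
proof -
  have ii: "gE i i 0 \<in> Fdeg 0" "gE (i + 1) (i + 1) 0 \<in> Fdeg 0"
    using i by (auto intro!: gE_Fdeg)
  show ?thesis
    unfolding ev_hi1_def Let_def
    using i ev_h_Fdeg[OF i] Fdeg_mult[OF Fdeg_scal_mult[OF ii(1)] ii(2)]
    by (intro rep_add rep_smult rep_comp_series rep_to_comp series_term Fdeg_diff Fdeg_scal_mult) auto
qed

end

section \<open>Approximation by a subring\<close>

text \<open>\<open>A\<close> will be the image of the evaluation map, of which these closure
  properties are recorded.\<close>

locale approximating_subring = affine_gl +
  fixes A :: "ucomp set"
  assumes A_carrier: "A \<subseteq> carrier (Ucomp m n c z)"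
    and A_add: "x \<in> A \<Longrightarrow> y \<in> A \<Longrightarrow> x \<oplus>\<^bsub>Ucomp m n c z\<^esub> y \<in> A"
    and A_mult: "x \<in> A \<Longrightarrow> y \<in> A \<Longrightarrow> x \<otimes>\<^bsub>Ucomp m n c z\<^esub> y \<in> A"
    and A_scal: "to_comp m n c z (scal a) \<in> A"
begin

definition ap :: "int \<Rightarrow> nat \<Rightarrow> ggen falg \<Rightarrow> bool" where
  "ap d N f \<longleftrightarrow> (\<exists>y \<in> A. rep y d N f)"

lemma ap_mono: "ap d N f \<Longrightarrow> M \<le> N \<Longrightarrow> ap d M f"
  unfolding ap_def using rep_mono A_carrier by blast

lemma ap_eqv: "ap d N f \<Longrightarrow> eqv f g \<Longrightarrow> g \<in> Fdeg d \<Longrightarrow> ap d N g"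
  unfolding ap_def
  by (auto intro!: rep_cong[of _ d N f g] bexI
      simp: rep_def K_def Fdeg_diff eqv_def cl_diff cl_closed J_zero U.r_neg a_minus_def)

lemma ap_add: "ap d N f \<Longrightarrow> ap d N g \<Longrightarrow> ap d N (f + g)"
  unfolding ap_def by (blast intro: rep_add A_add)

text \<open>The condition on levels is that of \<open>J_rmult\<close>: the left factor must be known
  to higher precision if \<open>e\<close> is negative.\<close>

lemma ap_mult: "ap d M f \<Longrightarrow> ap e N g \<Longrightarrow> int N \<le> int M + e \<Longrightarrow> ap (d + e) N (f * g)"
proof -
  assume "ap d M f" "ap e N g" "int N \<le> int M + e"
  then have "ap d (nat (int N - e)) f" by (auto intro: ap_mono[of d M f "nat (int N - e)"])
  then obtain x where "x \<in> A" "rep x d (nat (int N - e)) f" unfolding ap_def by blast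
  moreover obtain y where "y \<in> A" "rep y e N g" using \<open>ap e N g\<close> unfolding ap_def by blast
  ultimately show ?thesis
    unfolding ap_def by (intro bexI[of _ "x \<otimes>\<^bsub>Ucomp m n c z\<^esub> y"] rep_mult A_mult)
qed

lemma ap_scal: "ap 0 N (scal a)"
  unfolding ap_def using rep_to_comp[OF Fdeg_scal] A_scal by blast

lemma ap_scal_mult: "ap d N f \<Longrightarrow> ap d N (scal a * f)"
  using ap_mult[OF ap_scal[of "nat (int N - d)" a], of d N f] by simp

lemma ap_minus: "ap d N f \<Longrightarrow> ap d N (- f)"
  using ap_scal_mult[of d N f "- 1"] by (simp add: scal_uminus scal_one)

lemma ap_diff: "ap d N f \<Longrightarrow> ap d N g \<Longrightarrow> ap d N (f - g)"
  using ap_add[OF _ ap_minus, of d N f g] by simp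

lemma ap_zero: "ap d N 0"
proof -
  have "rep (to_comp m n c z (scal 0)) d N 0"
    using rep_to_comp[OF Fdeg_zero] by (simp add: scal_zero)
  then show ?thesis unfolding ap_def using A_scal by blast
qed

lemma ap_sum: "(\<And>x. x \<in> S \<Longrightarrow> ap d N (f x)) \<Longrightarrow> ap d N (sum f S)"
  by (induction S rule: infinite_finite_induct) (auto intro: ap_zero ap_add)

lemma ap_scal_cancel: "ap d N (scal a * f) \<Longrightarrow> a \<noteq> 0 \<Longrightarrow> ap d N f"
  using ap_scal_mult[of d N "scal a * f" "1 / a"]
  by (simp add: scal_one flip: mult.assoc scal_mult)

text \<open>The approximating element may depend on \<open>N\<close>, so \<open>f\<close> is placed
  in the closure of \<open>A\<close>, not in \<open>A\<close> itself.\<close>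

definition apx :: "int \<Rightarrow> ggen falg \<Rightarrow> bool" where
  "apx d f \<longleftrightarrow> (\<forall>N. ap d N f)"

lemma apx_mult: "apx d f \<Longrightarrow> apx e g \<Longrightarrow> apx (d + e) (f * g)"
  unfolding apx_def
proof
  fix N assume "\<forall>N. ap d N f" "\<forall>N. ap e N g"
  then show "ap (d + e) N (f * g)" by (intro ap_mult[of d "nat (int N - e)"]) auto
qed

lemma
  shows apx_eqv: "apx d f \<Longrightarrow> eqv f g \<Longrightarrow> g \<in> Fdeg d \<Longrightarrow> apx d g"
    and apx_add: "apx d f \<Longrightarrow> apx d g \<Longrightarrow> apx d (f + g)"
    and apx_diff: "apx d f \<Longrightarrow> apx d g \<Longrightarrow> apx d (f - g)"
    and apx_scal: "apx 0 (scal a)"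
    and apx_scal_mult: "apx d f \<Longrightarrow> apx d (scal a * f)"
    and apx_zero: "apx d 0"
    and apx_scal_cancel: "apx d (scal a * f) \<Longrightarrow> a \<noteq> 0 \<Longrightarrow> apx d f"
    and apx_sum: "(\<And>x. x \<in> S \<Longrightarrow> apx d (h x)) \<Longrightarrow> apx d (sum h S)"
  unfolding apx_def
  by (blast intro: ap_eqv ap_add ap_diff ap_scal ap_scal_mult ap_zero ap_scal_cancel ap_sum)+

section \<open>Matrix units generated by brackets\<close>

abbreviation apE :: "nat \<Rightarrow> nat \<Rightarrow> int \<Rightarrow> bool" where
  "apE i j u \<equiv> apx u (gE i j u)"

lemma apE_bracket:
  assumes "i \<in> idx" "j \<in> idx" "k \<in> idx" "l \<in> idx" "apE i j u" "apE k l v"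
  shows "apx (u + v) (bracket_value m c z i j u k l v)"
proof -
  have "apx (u + v) (gE k l v * gE i j u)"
    using apx_mult[OF assms(6,5)] by (simp add: add.commute)
  then have "apx (u + v) (gE i j u * gE k l v
      - scal ((-1) ^ ((pr m i + pr m j) * (pr m k + pr m l))) * (gE k l v * gE i j u))"
    by (rule apx_diff[OF apx_mult[OF assms(5,6)] apx_scal_mult])
  then show ?thesis
    using eqv_bracket bracket_value_Fdeg assms by (blast intro: apx_eqv)
qed

text \<open>\<open>a \<noteq> d\<close> removes the second matrix unit and both central
  terms.\<close>

lemma apE_trans:
  assumes "a \<in> idx" "b \<in> idx" "d \<in> idx" "apE a b u" "apE b d v" "a \<noteq> d"
  shows "apE a d (u + v)"
proof -
  have "bracket_value m c z a b u b d v = gE a d (u + v)"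
    using assms(6) by (auto simp: bracket_value_def scal_zero)
  then show ?thesis using apE_bracket[OF assms(1,2,2,3,4,5)] by simp
qed

text \<open>There is no central term because the first factor has degree 0.\<close>

lemma apE_diag:
  assumes "a \<in> idx" "b \<in> idx" "apE a b 0" "apE b a u" "a \<noteq> b"
  shows "apx u (gE a a u - scal ((-1) ^ ((pr m a + pr m b) * (pr m b + pr m a))) * gE b b u)"
  using apE_bracket[OF assms(1,2,2,1,3,4)] by (auto simp: bracket_value_def scal_zero split: if_splits)

text \<open>The coefficient of \<open>E_bb(u)\<close> in \<open>apE_diag\<close> is a sign, hence
  invertible.\<close>

lemma apE_diag_transfer:
  assumes "a \<in> idx" "b \<in> idx" "apE a b 0" "apE b a u" "a \<noteq> b" "apE a a u"
  shows "apE b b u"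
proof -
  let ?s = "(-1) ^ ((pr m a + pr m b) * (pr m b + pr m a)) :: complex"
  have "apx u (gE a a u - (gE a a u - scal ?s * gE b b u))"
    using apE_diag[OF assms(1-5)] assms(6) by (rule apx_diff[rotated])
  then show ?thesis by (auto intro: apx_scal_cancel)
qed

text \<open>Brackets with degree-zero units change first the row and then the column of
  \<open>E_pq(u)\<close>.\<close>

lemma apE_offdiag_shift:
  assumes 0: "\<And>a b. a \<in> idx \<Longrightarrow> b \<in> idx \<Longrightarrow> a \<noteq> b \<Longrightarrow> apE a b 0"
    and pq: "apE p q u" "p \<in> idx" "q \<in> idx" "p \<noteq> q"
    and ab: "a \<in> idx" "b \<in> idx" "a \<noteq> b" and three: "m + n \<ge> 3"
  shows "apE a b u"
proof -
  have 1: "apE a q u" if "a \<in> idx" "a \<noteq> q" for a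
    using apE_trans[OF that(1) pq(2,3) 0 pq(1)] that pq by (cases "a = p") auto
  have 2: "apE a b u" if "a \<in> idx" "a \<noteq> q" "b \<in> idx" "a \<noteq> b" for a b
    using apE_trans[OF that(1) pq(3) that(3) 1 0] that pq by (cases "b = q") (auto intro: 1)
  \<comment> \<open>Row \<open>q\<close> is reached through a third index, since bracketing
    \<open>E_qp\<close> with \<open>E_pq\<close> gives a diagonal element.\<close>
  obtain r where r: "r \<in> idx" "r \<noteq> q" "r \<noteq> b"
  proof -
    have "card {q, b} < card idx" using three by (auto intro: le_less_trans[OF card_insert_le_m1])
    then have "\<not> idx \<subseteq> {q, b}" by (metis card_mono finite.emptyI finite_insert leD)
    then show ?thesis using that by blast
  qed
  show ?thesis
  proof (cases "a = q")
    case True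
    have "apE q r 0" using 0 r pq(3) by auto
    moreover have "apE r b u" using 2 r ab(2) by auto
    ultimately show ?thesis
      using apE_trans[OF pq(3) r(1) ab(2), of 0 u] True ab(3) by simp
  next
    case False
    then show ?thesis using 2 ab by blast
  qed
qed

text \<open>Simple root vectors give degree 0, the affine ones give degrees 1 and -1, and brackets
  with these reach every degree.\<close>

lemma apE_offdiag:
  assumes simple: "\<And>i. 1 \<le> i \<Longrightarrow> i < m + n \<Longrightarrow> apE i (i + 1) 0 \<and> apE (i + 1) i 0"
    and affine: "apE (m + n) 1 1" "apE 1 (m + n) (-1)" and three: "m + n \<ge> 3"
    and ab: "a \<in> idx" "b \<in> idx" "a \<noteq> b"
  shows "apE a b u"
proof -
  have up: "apE a b 0 \<and> apE b a 0" if "1 \<le> a" "a < b" "b \<le> m + n" for a b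
  proof -
    from \<open>a < b\<close> have "Suc a \<le> b" by simp
    then show ?thesis using \<open>b \<le> m + n\<close>
    proof (induction b rule: dec_induct)
      case base
      then show ?case using simple[of a] that(1) by simp
    next
      case (step b)
      then have *: "apE a b 0" "apE b a 0" "apE b (Suc b) 0" "apE (Suc b) b 0" and "a \<in> idx" "b \<in> idx" "Suc b \<in> idx" "a \<noteq> Suc b"
        using simple[of b] that(1) by auto
      then show ?case
        using apE_trans[of a b "Suc b" 0 0] apE_trans[of "Suc b" b a 0 0] by simp
    qed
  qed
  have 0: "apE a b 0" if "a \<in> idx" "b \<in> idx" "a \<noteq> b" for a b
    using up[of a b] up[of b a] that by (cases "a < b") auto
  have 1: "apE a b 1" "apE a b (-1)" if "a \<in> idx" "b \<in> idx" "a \<noteq> b" for a b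
    using apE_offdiag_shift[OF 0 affine(1)] apE_offdiag_shift[OF 0 affine(2)] that three by auto
  have step: "apE a b (u + v)"
    if "\<And>a b. a \<in> idx \<Longrightarrow> b \<in> idx \<Longrightarrow> a \<noteq> b \<Longrightarrow> apE a b u"
      "\<And>a b. a \<in> idx \<Longrightarrow> b \<in> idx \<Longrightarrow> a \<noteq> b \<Longrightarrow> apE a b v"
      "a \<in> idx" "b \<in> idx" "a \<noteq> b" for a b u v
  proof -
    \<comment> \<open>An intermediate index \<open>r\<close> outside \<open>a\<close> and
      \<open>b\<close> keeps both factors off-diagonal.\<close>
    have "card {a, b} < card idx" using three by (auto intro: le_less_trans[OF card_insert_le_m1])
    then have "\<not> idx \<subseteq> {a, b}" by (metis card_mono finite.emptyI finite_insert leD)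
    then obtain r where "r \<in> idx" "r \<noteq> a" "r \<noteq> b" by blast
    then show ?thesis
      using apE_trans[of a r b u v] that by auto
  qed
  have "\<forall>a\<in>idx. \<forall>b\<in>idx. a \<noteq> b \<longrightarrow> apE a b u"
  proof (induction u rule: int_induct[where k = 0])
    case base
    then show ?case using 0 by blast
  next
    case (step1 i)
    then show ?case using step[of i 1] 1(1) by blast
  next
    case (step2 i)
    then show ?case using step[of i "-1"] 1(2) by (metis add_uminus_conv_diff)
  qed
  then show ?thesis using ab by blast
qed

text \<open>A homogeneous element is a combination of words of its degree, and the central
  generators equal scalars in \<open>U\<close>.\<close>

lemma levelwise_if_generators:
  assumes "\<And>i j u. i \<in> idx \<Longrightarrow> j \<in> idx \<Longrightarrow> apE i j u" and "f \<in> Fdeg d"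
  shows "apx d f"
proof -
  have gen: "apx (gdeg g) (gen g)" if "g \<in> ggens m n" for g
  proof (cases g)
    case (GE i j s)
    then show ?thesis using that assms(1) by (auto simp: ggens_def)
  next
    case GC
    then show ?thesis
      using apx_eqv[OF apx_scal eqv_sym[OF eqv_GC]] Fdeg_gen[OF that] by simp
  next
    case GZ
    then show ?thesis
      using apx_eqv[OF apx_scal eqv_sym[OF eqv_GZ]] Fdeg_gen[OF that] by simp
  qed
  have word: "apx (wdeg w) (Poly_Mapping.single w a)" if "set w \<subseteq> ggens m n" for w a
    using that
  proof (induction w)
    case Nil
    then show ?case using apx_scal[of a] by (simp add: scal_def wdeg_def)
  next
    case (Cons g w)
    have "gen g * Poly_Mapping.single w a = Poly_Mapping.single (g # w) a"
      by (simp add: gen_def mult_single plus_list_def)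
    then show ?case using apx_mult[OF gen[of g] Cons.IH] Cons.prems by (simp add: wdeg_def)
  qed
  have "apx d (\<Sum>w \<in> Poly_Mapping.keys f. Poly_Mapping.single w (Poly_Mapping.lookup f w))"
    using assms(2) word by (intro apx_sum) (auto simp: Fdeg_def free_algebra_def)
  then show ?thesis by (simp add: sum_single_lookup)
qed

text \<open>Degrees \<open>u \<noteq> 0\<close> come first, from the commutator with
  \<open>V\<close>; they then reduce \<open>V\<close> to a product of degree-zero units, which
  settles \<open>u = 0\<close>.\<close>

lemma apE_11:
  assumes m: "m \<ge> 2" and c: "c \<noteq> 0"
    and off: "\<And>a b u. a \<in> idx \<Longrightarrow> b \<in> idx \<Longrightarrow> a \<noteq> b \<Longrightarrow> apE a b u"
    and V: "\<And>N. ap 0 N (V N)"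
  shows "apE 1 1 u"
proof -
  have pr [simp]: "pr m 1 = 0" "pr m (Suc 0) = 0" "pr m 2 = 0" using m by (auto simp: pr_def)
  have idx: "1 \<in> idx" "2 \<in> idx" using m by auto
  have cls: "gE a b s \<in> carrier F" if "a \<in> {1, 2}" "b \<in> {1, 2}" for a b s
    using gE_Fdeg[of a b s] that m by (auto intro: Fdeg_carrier)
  have H: "apx u (gE 1 1 u - gE 2 2 u)" for u
    using apE_diag[OF idx off off, of u] idx by (simp add: scal_one)
  have nz: "apE 1 1 u \<and> apE 2 2 u" if u: "u \<noteq> 0" for u
  proof -
    have deg: "scal (- of_int u * c) * (gE 1 1 u + gE 2 2 u) \<in> Fdeg u"
      by (intro Fdeg_scal_mult Fdeg_add gE_Fdeg idx)
    have "ap u N (scal (- of_int u * c) * (gE 1 1 u + gE 2 2 u))" for N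
    proof -
      \<comment> \<open>The extra \<open>\<bar>u\<bar>\<close> levels serve twice: they make
        \<open>eqv_comm_V\<close> applicable and offset the loss in right multiplication by an
        element of degree \<open>u\<close>.\<close>
      let ?M = "N + nat \<bar>u\<bar>"
      have "ap u N (V ?M * (gE 1 1 u - gE 2 2 u))"
        using ap_mult[of 0 ?M "V ?M" u N] V[of ?M] H by (auto simp: apx_def)
      moreover have "ap u N ((gE 1 1 u - gE 2 2 u) * V ?M)"
        using ap_mult[of u N "gE 1 1 u - gE 2 2 u" 0 N "V ?M"] ap_mono[OF V[of ?M], of N] H
        by (auto simp: apx_def)
      ultimately show ?thesis
        using ap_eqv[OF ap_diff eqv_comm_V[OF m u] deg] by simp
    qed
    then have "apx u (scal (- of_int u * c) * (gE 1 1 u + gE 2 2 u))"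
      unfolding apx_def by blast
    from apx_scal_cancel[OF this] have "apx u (gE 1 1 u + gE 2 2 u)"
      using u c by simp
    then have "apx u ((gE 1 1 u + gE 2 2 u) + (gE 1 1 u - gE 2 2 u))"
      "apx u ((gE 1 1 u + gE 2 2 u) - (gE 1 1 u - gE 2 2 u))"
      using H by (blast intro: apx_add, blast intro: apx_diff)
    moreover have "(gE 1 1 u + gE 2 2 u) + (gE 1 1 u - gE 2 2 u) = scal 2 * gE 1 1 u"
      "(gE 1 1 u + gE 2 2 u) - (gE 1 1 u - gE 2 2 u) = scal 2 * gE 2 2 u"
      by (simp_all add: scal_two_mult)
    ultimately show ?thesis by (auto intro: apx_scal_cancel)
  qed
  define e where "e = gE 1 1 0"
  define h where "h = gE 1 1 0 - gE 2 2 0"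
  define x where "x = gE 1 2 1"
  define y where "y = gE 2 1 (-1)"
  note defs = e_def h_def x_def y_def
  have cl: "e \<in> carrier F" "h \<in> carrier F" "x \<in> carrier F" "y \<in> carrier F"
    by (simp_all add: defs cls free_algebra_closed)
  have deg: "e \<in> Fdeg 0" "x \<in> Fdeg 1"
    using idx by (simp_all add: defs gE_Fdeg)
  have ap: "apx 0 h" "apx 1 x" "apx (-1) y"
    using H off idx by (simp_all add: defs)
  have eh: "apx 0 (e * h)"
    unfolding apx_def
  proof
    fix N :: nat
    \<comment> \<open>The term \<open>s = 0\<close> of the first sum is kept; with the last product
      in \<open>V N\<close> it forms \<open>e * h\<close>.\<close>
    have split: "{..N} = insert 0 {1..N}" by auto
    have "apx 0 (\<Sum>s = 1..N. gE 1 1 (- int s) * gE 1 1 (int s))"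
      using nz apx_mult[of "- int s" "gE 1 1 (- int s)" "int s" "gE 1 1 (int s)" for s]
      by (intro apx_sum) simp
    moreover have "apx 0 (\<Sum>s\<le>N. gE 2 2 (- int s - 1) * gE 2 2 (int s + 1))"
      using nz apx_mult[of "- int s - 1" "gE 2 2 (- int s - 1)" "int s + 1" "gE 2 2 (int s + 1)" for s]
      by (intro apx_sum) simp
    ultimately have "ap 0 N (V N - (\<Sum>s = 1..N. gE 1 1 (- int s) * gE 1 1 (int s))
        + (\<Sum>s\<le>N. gE 2 2 (- int s - 1) * gE 2 2 (int s + 1)))"
      using V by (auto simp: apx_def intro!: ap_add ap_diff)
    moreover have "V N - (\<Sum>s = 1..N. gE 1 1 (- int s) * gE 1 1 (int s))
        + (\<Sum>s\<le>N. gE 2 2 (- int s - 1) * gE 2 2 (int s + 1)) = e * h"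
      by (simp add: V_def split defs algebra_simps)
    ultimately show "ap 0 N (e * h)" by simp
  qed
  have hx: "eqv (h * x - x * h) (x + x)"
  proof -
    have "h * x - x * h = (gE 1 1 0 * x - x * gE 1 1 0) - (gE 2 2 0 * x - x * gE 2 2 0)"
      by (simp add: h_def algebra_simps)
    then show ?thesis
      using eqv_diff[OF eqv_matrix_units(1,2)[OF m]] by (simp add: x_def)
  qed
  have ex: "eqv (e * x - x * e) x"
    using eqv_matrix_units(1)[OF m] by (simp add: defs)
  \<comment> \<open>The commutator of \<open>e * h\<close> with \<open>x\<close> is
    \<open>2 * e * x + x * h\<close>; the known product \<open>x * h\<close> is subtracted.\<close>
  have "apx 1 (e * h * x - x * (e * h) - x * h)"
    using apx_mult[OF eh ap(2)] apx_mult[OF ap(2) eh] apx_mult[OF ap(2,1)]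
    by (intro apx_diff) simp_all
  moreover have "eqv (e * h * x - x * (e * h) - x * h) (e * (x + x) + x * h - x * h)"
    by (intro eqv_diff[OF eqv_comm_mult[OF ex hx cl(1,2)]] eqv_refl free_algebra_closed cl)
  moreover have "e * (x + x) + x * h - x * h = scal 2 * (e * x)"
    by (simp add: scal_two_mult distrib_left)
  moreover have "scal 2 * (e * x) \<in> Fdeg 1"
    using Fdeg_scal_mult[OF Fdeg_mult[OF deg(1,2)]] by simp
  ultimately have "apx 1 (scal 2 * (e * x))"
    using apx_eqv by metis
  then have ex': "apx 1 (e * x)"
    by (rule apx_scal_cancel) simp
  have xy: "eqv (x * y - y * x) (h + scal c)" and ey: "eqv (e * y - y * e) (- y)"
    using eqv_matrix_units(3,4)[OF m] by (simp_all add: defs)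
  \<comment> \<open>The commutator of \<open>e * x\<close> with \<open>y\<close> is
    \<open>e * h + c * e - y * x\<close>; the known products are removed and \<open>c * e\<close>
    remains.\<close>
  have "apx 0 (e * x * y - y * (e * x) + y * x - e * h)"
    using apx_mult[OF ex' ap(3)] apx_mult[OF ap(3) ex'] apx_mult[OF ap(3,2)] eh
    by (intro apx_diff apx_add) simp_all
  moreover have "eqv (e * x * y - y * (e * x) + y * x - e * h)
      (e * (h + scal c) + - y * x + y * x - e * h)"
    by (intro eqv_diff[OF eqv_add[OF eqv_comm_mult[OF ey xy cl(1,3)]]] eqv_refl free_algebra_closed cl)
  moreover have "e * (h + scal c) + - y * x + y * x - e * h = scal c * e"
    by (simp add: algebra_simps scal_comm)
  ultimately have "apx 0 (scal c * e)"
    using apx_eqv Fdeg_scal_mult[OF deg(1)] by metis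
  then have "apE 1 1 0"
    using c apx_scal_cancel by (auto simp: e_def)
  then show ?thesis using nz by (cases "u = 0") auto
qed

section \<open>Extracting \<open>V\<close> from the image of \<open>h_{1,1}\<close>\<close>

lemma apx_to_comp: "to_comp m n c z f \<in> A \<Longrightarrow> f \<in> Fdeg d \<Longrightarrow> apx d f"
  unfolding apx_def ap_def using rep_to_comp by blast

text \<open>Products \<open>E_ik E_ki\<close> with \<open>k \<noteq> i\<close> and the multiple of
  \<open>E_11 - E_22\<close> are approximated already; without them the truncated image is
  \<open>(\<epsilon>1 + \<epsilon>2) * V N\<close>.\<close>

lemma ap_V:
  assumes m: "m \<ge> 2" and "\<epsilon>1 + \<epsilon>2 \<noteq> 0"
    and off: "\<And>a b u. a \<in> idx \<Longrightarrow> b \<in> idx \<Longrightarrow> a \<noteq> b \<Longrightarrow> apE a b u"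
    and A: "ev_hi1 m n \<epsilon>1 \<epsilon>2 \<alpha> c z 1 \<in> A"
  shows "ap 0 N (V N)"
proof -
  have pr [simp]: "pr m 1 = 0" "pr m (Suc 0) = 0" "pr m 2 = 0" using m by (auto simp: pr_def)
  have idx: "1 \<in> idx" "2 \<in> idx" using m by auto
  define a where "a = \<alpha> - \<epsilon>1"
  define h where "h = \<epsilon>1 + \<epsilon>2"
  define S2 where "S2 = (\<Sum>s\<le>N. \<Sum>k = 2..m + n.
             scal ((-1) ^ pr m k) * gE 1 k (- int s - 1) * gE k 1 (int s + 1))"
  define S3 where "S3 = (\<Sum>s\<le>N. gE 2 1 (- int s) * gE 1 2 (int s))"
  define S4 where "S4 = (\<Sum>s\<le>N. \<Sum>k = 3..m + n.
             scal ((-1) ^ pr m k) * gE 2 k (- int s - 1) * gE k 2 (int s + 1))"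
  \<comment> \<open>The form in which simplification leaves the coefficient of the last two
    series.\<close>
  have neg: "scal (- \<epsilon>1 - \<epsilon>2) = - scal (\<epsilon>1 + \<epsilon>2)"
    by (simp flip: scal_uminus)
  \<comment> \<open>In the fourth series the term \<open>k = 2\<close> is diagonal and belongs to
    \<open>V N\<close>; its other terms are off-diagonal and go into \<open>S4\<close>.\<close>
  have split: "{2..m + n} = insert 2 {3..m + n}" using m by auto
  have "rep (ev_hi1 m n \<epsilon>1 \<epsilon>2 \<alpha> c z 1) 0 N
     (scal a * (gE 1 1 0 - gE 2 2 0) - scal h * gE 1 1 0 * gE 2 2 0
      + scal h * (\<Sum>s\<le>N. gE 1 1 (- int s) * gE 1 1 (int s)) + scal h * S2
      - scal h * S3 - scal h * ((\<Sum>s\<le>N. gE 2 2 (- int s - 1) * gE 2 2 (int s + 1)) + S4))"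
    using rep_ev_hi1[of 1 \<epsilon>1 \<epsilon>2 \<alpha> N] m
    by (simp add: ev_h_def a_def h_def S2_def S3_def S4_def scal_one neg split
        sum.distrib numeral_2_eq_2[symmetric])
  then have T: "ap 0 N (scal a * (gE 1 1 0 - gE 2 2 0) - scal h * gE 1 1 0 * gE 2 2 0
      + scal h * (\<Sum>s\<le>N. gE 1 1 (- int s) * gE 1 1 (int s)) + scal h * S2
      - scal h * S3 - scal h * ((\<Sum>s\<le>N. gE 2 2 (- int s - 1) * gE 2 2 (int s + 1)) + S4))"
    (is "ap 0 N ?T")
    using A unfolding ap_def by blast
  have D: "ap 0 N (gE 1 1 0 - gE 2 2 0)"
    using apE_diag[OF idx off off, of 0] idx by (simp add: scal_one apx_def)
  have prod: "apx 0 (scal t * gE i k q * gE k i r)"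
    if "i \<in> idx" "k \<in> idx" "k \<noteq> i" "q = - r" for t i k q r
    using apx_mult[OF apx_scal_mult[OF off[of i k q]] off[of k i r], of t] that by simp
  have S: "ap 0 N S2" "ap 0 N S4"
    unfolding S2_def S4_def
    using idx by (auto intro!: ap_sum prod[unfolded apx_def, rule_format])
  have S3: "ap 0 N S3"
    unfolding S3_def using prod[of 2 1 _ _ 1] idx
    by (intro ap_sum) (simp add: apx_def scal_one)
  have "ap 0 N (?T - scal a * (gE 1 1 0 - gE 2 2 0) - scal h * S2 + scal h * S3 + scal h * S4)"
    by (rule ap_add[OF ap_add[OF ap_diff[OF ap_diff[OF T ap_scal_mult[OF D]]
          ap_scal_mult[OF S(1)]] ap_scal_mult[OF S3]] ap_scal_mult[OF S(2)]])
  moreover have "?T - scal a * (gE 1 1 0 - gE 2 2 0) - scal h * S2 + scal h * S3 + scal h * S4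
      = scal h * V N"
    by (simp add: V_def algebra_simps)
  ultimately show ?thesis
    using assms(2) by (auto simp: h_def intro: ap_scal_cancel)
qed

end

section \<open>Density of the image of the evaluation map\<close>

theorem theorem3p29:
  fixes m n :: nat and \<epsilon>1 \<epsilon>2 \<alpha> c z hbar :: complex
    and ev :: "ygen falg set \<Rightarrow> ucomp"
  assumes "m \<ge> 2" and "n \<ge> 2" and "m \<noteq> n"
    and "hbar = \<epsilon>1 + \<epsilon>2"
    and "hbar * c = (- of_nat m + of_nat n) * \<epsilon>1"
    and "z = 1"
    and "is_evaluation_map m n \<epsilon>1 \<epsilon>2 \<alpha> c z ev"
    and "\<epsilon>1 \<noteq> 0"
  shows "Ucomp_topology m n c z closure_of (ev ` carrier (affine_super_yangian m n \<epsilon>1 \<epsilon>2))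
         = carrier (Ucomp m n c z)"
proof -
  let ?Y = "affine_super_yangian m n \<epsilon>1 \<epsilon>2"
  let ?A = "ev ` carrier ?Y"
  have hom: "ev \<in> ring_hom ?Y (Ucomp m n c z)"
    and scal: "\<And>a. ev (ycls m n \<epsilon>1 \<epsilon>2 (scal a)) = to_comp m n c z (scal a)"
    and x: "\<And>\<sigma> i. i < m + n \<Longrightarrow> ev (ycls m n \<epsilon>1 \<epsilon>2 (yx \<sigma> i 0)) = to_comp m n c z (ev_x m n \<sigma> i)"
    and h: "\<And>i. i \<in> {1..<m + n} \<Longrightarrow> ev (ycls m n \<epsilon>1 \<epsilon>2 (yh i 1)) = ev_hi1 m n \<epsilon>1 \<epsilon>2 \<alpha> c z i"
    using assms(7) unfolding is_evaluation_map_def by blast+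
  interpret Y: ring ?Y
    using assms(1,2) by (intro ring_affine_super_yangian) auto
  have Y: "ycls m n \<epsilon>1 \<epsilon>2 f \<in> carrier ?Y" if "f \<in> carrier (free_algebra (ygens m n))" for f
    using pcls_closed[OF that] by (simp add: ycls_def affine_super_yangian_def)
  interpret approximating_subring m n c z ?A
  proof
    show "?A \<subseteq> carrier (Ucomp m n c z)"
      using ring_hom_closed[OF hom] by blast
    show "u \<oplus>\<^bsub>Ucomp m n c z\<^esub> v \<in> ?A" if "u \<in> ?A" "v \<in> ?A" for u v
      using that Y.a_closed by (auto simp flip: ring_hom_add[OF hom])
    show "u \<otimes>\<^bsub>Ucomp m n c z\<^esub> v \<in> ?A" if "u \<in> ?A" "v \<in> ?A" for u v
      using that Y.m_closed by (auto simp flip: ring_hom_mult[OF hom])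
    show "to_comp m n c z (scal a) \<in> ?A" for a
      using Y[OF scal_closed] by (simp flip: scal)
  qed
  have c: "c \<noteq> 0" "\<epsilon>1 + \<epsilon>2 \<noteq> 0"
    using assms(3,4,5,8) by auto
  have gens: "to_comp m n c z (ev_x m n \<sigma> i) \<in> ?A" if "i < m + n" for \<sigma> i
    using Y[OF gen_closed, of "YX \<sigma> i 0"] that by (simp add: ygens_def flip: x)
  have simple: "apE i (i + 1) 0 \<and> apE (i + 1) i 0" if "1 \<le> i" "i < m + n" for i
  proof
    show "apE i (i + 1) 0"
      using apx_to_comp[OF gens[of i Pl]] gE_Fdeg[of i "i + 1" 0] that by simp
    have "apx 0 (scal ((-1) ^ pr m i) * gE (i + 1) i 0)"
      using apx_to_comp[OF gens[of i Mi]] Fdeg_scal_mult[OF gE_Fdeg[of "i + 1" i 0]] that by simp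
    then show "apE (i + 1) i 0" by (rule apx_scal_cancel) simp
  qed
  have affine: "apE (m + n) 1 1"
    using apx_to_comp[OF gens[of 0 Pl]] gE_Fdeg[of "m + n" 1 1] assms(1) by simp
  have affine': "apE 1 (m + n) (-1)"
  proof -
    have "apx (-1) (- gE 1 (m + n) (-1))"
      using apx_to_comp[OF gens[of 0 Mi]] Fdeg_minus[OF gE_Fdeg[of 1 "m + n" "-1"]] assms(1) by simp
    from apx_diff[OF apx_zero this] show ?thesis by simp
  qed
  have "m + n \<ge> 3" using assms(1,2) by simp
  then have off: "apE a b u" if "a \<in> idx" "b \<in> idx" "a \<noteq> b" for a b u
    using apE_offdiag[OF simple affine affine' _ that] by blast
  have "ev_hi1 m n \<epsilon>1 \<epsilon>2 \<alpha> c z 1 \<in> ?A"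
    using Y[OF gen_closed, of "YH 1 1"] assms(1) h[of 1] by (force simp: ygens_def)
  then have "ap 0 N (V N)" for N
    by (rule ap_V[OF assms(1) c(2), rotated]) (rule off)
  then have "apE 1 1 u" for u
    by (rule apE_11[OF assms(1) c(1), rotated]) (rule off)
  \<comment> \<open>The off-diagonal units carry \<open>E_11(u)\<close> to every other diagonal
    unit, including those of odd index.\<close>
  then have "apE i j u" if "i \<in> idx" "j \<in> idx" for i j u
    using apE_diag_transfer[of 1 i u] off that by (cases "i = j"; cases "i = 1") auto
  then have "apx d f" if "f \<in> Fdeg d" for d f
    using levelwise_if_generators that by blast
  \<comment> \<open>\<open>J\<close> is the zero of the completion and the image of the scalar
    0.\<close>
  moreover have "J \<in> ?A"
    using A_scal[of 0] by (simp add: scal_zero to_comp_zero)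
  ultimately show ?thesis
    using A_carrier A_add by (intro dense_if_levelwise) (auto simp: apx_def ap_def)
qed

end
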